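(* Let $\beta\in(0,2)$ and $\beta_*=\frac{1+\sqrt5}{2}$. Consider the fractional discrete Laplacian $-(-\Delta)^{\frac\beta2}$ in one dimension, i.e. the operator generated by the kernel $k_\beta^*$ given in the context. (a) If $\beta\in(0,\beta_*]$, then there exist constants $\tilde c_1,\tilde c_2,\nu>0$ such that $-(-\Delta)^{\frac\beta2}$ satisfies $CD_\Upsilon(0,F)$ with a $CD$-function $F$ such that $F(x)\sim\tilde c_1x^{\frac{1+2\beta}{\beta}}$ as $x\to0$ and $F(x)\sim\tilde c_2e^{\nu x}$ as $x\to\infty$. (b) If $\beta\in(\beta_*,2)$, then for every $\varepsilon\in(0,\beta-1)$ (arbitrarily small) there exist constants $\tilde c_3,\tilde c_4,\nu>0$ such that $-(-\Delta)^{\frac\beta2}$ satisfies $CD_\Upsilon(0,F)$ with a $CD$-function $F$ such that $F(x)\sim\tilde c_3x^{\frac{\beta-\varepsilon}{\beta-\varepsilon-1}}$ as $x\to0$ and $F(x)\sim\tilde c_4e^{\nu x}$ as $x\to\infty$.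
   Context: For a kernel $k:\mathbb{Z}\to[0,\infty)$ that is not identically zero, with $k(0)=0$, $k(j)=k(-j)$ and $\sum_{j}k(j)<\infty$, the operator generated by $k$ is $Lu(x)=\sum_{j\in\mathbb{Z}}k(j)\big(u(x+j)-u(x)\big)$, $x\in\mathbb{Z}$. The fractional discrete Laplacian $-(-\Delta)^{\beta/2}$, $\beta\in(0,2)$, is the operator generated by the kernel $$k_\beta^*(j)=\frac{4^{\beta/2}\,\Gamma\big(\frac{1+\beta}{2}\big)}{\sqrt\pi\,\big|\Gamma\big(-\frac\beta2\big)\big|}\cdot\frac{\Gamma\big(|j|-\frac\beta2\big)}{\Gamma\big(|j|+1+\frac\beta2\big)},\quad j\in\mathbb{Z}\setminus\{0\},\qquad k_\beta^*(0)=0,$$ where $\Gamma$ is the Gamma function. It is known that $c(\beta)|j|^{-1-\beta}\le k_\beta^*(j)\le C(\beta)|j|^{-1-\beta}$ for $j\ne0$, with constants $c(\beta),C(\beta)>0$. $\ell^\infty(\mathbb{Z})$ denotes the bounded functions $\mathbb{Z}\to\mathbb{R}$. $f\sim g$ as $x\to x_0$ means $f(x)/g(x)\to1$ as $x\to x_0$. Let $\Upsilon(r)=e^r-1-r$, $r\in\mathbb{R}$. For $u,v\in\ell^\infty(\mathbb{Z})$ put $\Psi_\Upsilon(u)(x)=\sum_{y\in\mathbb{Z}}k(x-y)\Upsilon(u(y)-u(x))$, $B_{\Upsilon'}(u,v)(x)=\sum_{y\in\mathbb{Z}}k(x-y)\Upsilon'(u(y)-u(x))(v(y)-v(x))$ and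 $\Psi_{2,\Upsilon}(u)(x)=\frac12\big(L\Psi_\Upsilon(u)(x)-B_{\Upsilon'}(u,Lu)(x)\big)$. A $CD$-function is a continuous $F:[0,\infty)\to[0,\infty)$ with $F(0)=0$, $r\mapsto F(r)/r$ strictly increasing on $(0,\infty)$, and $1/F$ integrable at $\infty$. $L$ satisfies $CD_\Upsilon(0,F)$ if for every $u\in\ell^\infty(\mathbb{Z})$ and every $x\in\mathbb{Z}$: $\Psi_{2,\Upsilon}(u)(x)\ge F(-Lu(x))$ whenever $-Lu(x)\ge 0$ (and $\Psi_{2,\Upsilon}(u)(x)\ge 0$ otherwise). *)

theory Defs
  imports "HOL-Analysis.Analysis" "HOL-Library.Landau_Symbols"
begin

text \<open>All sums over the integers are unconditional sums. For a summable kernel \<open>k\<close> and bounded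
  \<open>u\<close>, \<open>v\<close> each of them converges absolutely, so the default value of \<open>infsum\<close> for
  non-summable families never enters.\<close>

definition gen_op :: "(int \<Rightarrow> real) \<Rightarrow> (int \<Rightarrow> real) \<Rightarrow> int \<Rightarrow> real" where
  "gen_op k u x = (\<Sum>\<^sub>\<infinity>j\<in>UNIV. k j * (u (x + j) - u x))"

definition frac_kernel :: "real \<Rightarrow> int \<Rightarrow> real" where
  "frac_kernel \<beta> j = (if j = 0 then 0 else
     4 powr (\<beta> / 2) * Gamma ((1 + \<beta>) / 2) / (sqrt pi * \<bar>Gamma (- (\<beta> / 2))\<bar>)
     * (Gamma (real_of_int \<bar>j\<bar> - \<beta> / 2) / Gamma (real_of_int \<bar>j\<bar> + 1 + \<beta> / 2)))"

definition Upsilon :: "real \<Rightarrow> real" where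
  "Upsilon r = exp r - 1 - r"

lemma deriv_Upsilon: "deriv Upsilon r = exp r - 1"
proof -
  have "(Upsilon has_real_derivative (exp r - 1)) (at r)"
    unfolding Upsilon_def by (auto intro!: derivative_eq_intros)
  then show ?thesis by (rule DERIV_imp_deriv)
qed

definition Psi_Upsilon :: "(int \<Rightarrow> real) \<Rightarrow> (int \<Rightarrow> real) \<Rightarrow> int \<Rightarrow> real" where
  "Psi_Upsilon k u x = (\<Sum>\<^sub>\<infinity>y\<in>UNIV. k (x - y) * Upsilon (u y - u x))"

definition B_Upsilon' :: "(int \<Rightarrow> real) \<Rightarrow> (int \<Rightarrow> real) \<Rightarrow> (int \<Rightarrow> real) \<Rightarrow> int \<Rightarrow> real" where
  "B_Upsilon' k u v x = (\<Sum>\<^sub>\<infinity>y\<in>UNIV. k (x - y) * deriv Upsilon (u y - u x) * (v y - v x))"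

definition Psi2_Upsilon :: "(int \<Rightarrow> real) \<Rightarrow> (int \<Rightarrow> real) \<Rightarrow> int \<Rightarrow> real" where
  "Psi2_Upsilon k u x = 1 / 2 * (gen_op k (Psi_Upsilon k u) x - B_Upsilon' k u (gen_op k u) x)"

text \<open>A CD-function is a map from \<open>[0,\<infinity>)\<close> to itself; here it is a total function on the reals
  whose values at negative arguments are irrelevant. The first and fourth conditions make it
  positive on \<open>(0,\<infinity>)\<close>, so integrability of \<open>1/F\<close> at infinity does not depend on the chosen
  lower bound \<open>R > 0\<close>.\<close>

definition CD_function :: "(real \<Rightarrow> real) \<Rightarrow> bool" where
  "CD_function F \<longleftrightarrow>
     (\<forall>r\<ge>0. F r \<ge> 0) \<and> continuous_on {0..} F \<and> F 0 = 0 \<and>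
     strict_mono_on {0<..} (\<lambda>r. F r / r) \<and>
     (\<exists>R>0. set_integrable lborel {R..} (\<lambda>r. 1 / F r))"

definition CD_Upsilon_0 :: "(int \<Rightarrow> real) \<Rightarrow> (real \<Rightarrow> real) \<Rightarrow> bool" where
  "CD_Upsilon_0 k F \<longleftrightarrow> (\<forall>u x. bounded (range u) \<longrightarrow>
     (if - gen_op k u x \<ge> 0 then Psi2_Upsilon k u x \<ge> F (- gen_op k u x)
      else Psi2_Upsilon k u x \<ge> 0))"

end

theory Submission
  imports Defs
begin

text \<open>
  Everything rests on an identity that turns the curvature operator into a sum of nonnegative
  terms (\<open>has_sum_Psi2\<close>):
  \<open>2 \<Psi>\<^sub>2\<^sub>,\<^sub>\<Upsilon>(u)(x) = \<Sum>\<^sub>j\<^sub>,\<^sub>l k(j) k(l) exp (u(x + l) - u(x)) \<Upsilon>(u(x + j + l) - u(x + j) - u(x + l) + u(x))\<close>.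
  In particular \<open>\<Psi>\<^sub>2\<^sub>,\<^sub>\<Upsilon> \<ge> 0\<close>. Put \<open>P = \<Psi>\<^sub>2\<^sub>,\<^sub>\<Upsilon>(u)(x)\<close>, \<open>s = - L u(x)\<close> and \<open>w n = 2 u(x) - u(x + n) - u(x - n)\<close>. Then \<open>s\<close> is the sum of
  \<open>k(n) w n\<close> over \<open>n \<ge> 1\<close>, and the antidiagonal terms \<open>l = - j\<close> give
  \<open>\<Sum>\<^sub>n k(n)\<^sup>2 4 sinh\<^sup>2(w n / 4) \<le> P\<close> (\<open>sum_sinh_sq_le_Psi2\<close>). So \<open>P\<close> has to be bounded below in terms of \<open>s\<close>, for a
  kernel comparable to \<open>n powr (- 1 - \<beta>)\<close>; that the fractional kernel is of this type follows from
  Euler's limit formula for the Gamma function (\<open>frac_kernel_bounds\<close>).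

  For large \<open>s\<close>, a single antidiagonal term bounds \<open>w n\<close> by the logarithm of \<open>P\<close> up to a summable
  correction, so that \<open>P\<close> is exponentially large in \<open>s\<close> (\<open>Psi2_ge_exp\<close>).

  For small \<open>s\<close>, jumps are split at a scale \<open>M\<close>. The duality inequality \<open>weighted_sum_le\<close> on both parts gives
  \<open>s \<le> K (M powr (- \<beta>) + M powr (1 + \<beta>) P)\<close>, and the best choice \<open>M \<approx> s powr (- 1 / \<beta>)\<close> yields the exponent \<open>2 + 1 / \<beta>\<close>
  of part (a) (\<open>Psi2_ge_powr\<close>).

  For \<open>\<beta> > 1\<close> the near jumps can be controlled better. The terms with \<open>l = \<plusminus>1\<close> measure how much the
  increments of \<open>u\<close> differ from the first one, and \<open>w n\<close> is a signed sum of these differences, so it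
  cannot be large for many \<open>n\<close> at once. This leads to the exponent \<open>\<beta> / (\<beta> - 1)\<close> (\<open>Psi2_ge_powr_improved\<close>).
  The exponents \<open>2 + 1 / \<beta>\<close> and \<open>\<beta> / (\<beta> - 1)\<close> agree exactly when \<open>\<beta>\<^sup>2 = \<beta> + 1\<close>, which is where the
  golden ratio comes from, and the exponents in part (b) exceed \<open>\<beta> / (\<beta> - 1)\<close>.

  Finally, \<open>c (r / (p / \<nu> + r)) powr p * exp (\<nu> r)\<close> is a CD-function with the required behaviour at
  \<open>0\<close> and \<open>\<infinity>\<close>, and for small \<open>c\<close> it lies below the bounds just described.
\<close>

section \<open>Elementary lower bounds for \<open>Upsilon\<close>\<close>

lemma Upsilon_nonneg: "0 \<le> Upsilon r"
  unfolding Upsilon_def using exp_ge_add_one_self[of r] by linarith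

lemma Upsilon_ge_square: "(exp (r / 2) - 1)\<^sup>2 \<le> Upsilon r"
proof -
  have "Upsilon r - (exp (r / 2) - 1)\<^sup>2 = 2 * Upsilon (r / 2)"
    unfolding Upsilon_def by (simp add: power2_eq_square algebra_simps flip: exp_add)
  then show ?thesis using Upsilon_nonneg[of "r / 2"] by linarith
qed

text \<open>At \<open>-\<infinity>\<close> the function \<open>Upsilon\<close> grows only linearly and does not dominate the square; the hypothesis keeps
  \<open>r\<close> away from there, since \<open>exp (r / 2)\<close> is within \<open>1 / 4\<close> of \<open>1\<close>.\<close>

lemma square_le_Upsilon:
  assumes "Upsilon r \<le> 1 / 16"
  shows "r\<^sup>2 \<le> 8 * Upsilon r"
proof -
  define y where "y = exp (r / 2) - 1"
  have y: "y\<^sup>2 \<le> Upsilon r" unfolding y_def by (rule Upsilon_ge_square)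
  then have "y\<^sup>2 \<le> (1/4)\<^sup>2" using assms by (simp add: power2_eq_square)
  then have y14: "\<bar>y\<bar> \<le> 1 / 4" by (simp add: power2_le_iff_abs_le)
  have "\<bar>r / 2\<bar> \<le> 4 / 3 * \<bar>y\<bar>"
  proof (cases "r \<ge> 0")
    case True
    have "r / 2 \<le> y" unfolding y_def using exp_ge_add_one_self[of "r / 2"] by linarith
    then show ?thesis using True by (auto simp: abs_if)
  next
    case False
    have pos: "1 + y > 0" using y14 by linarith
    have "- (r / 2) = ln (1 / (1 + y))" using pos by (simp add: ln_div y_def)
    also have "\<dots> \<le> 1 / (1 + y) - 1" using pos by (intro ln_le_minus_one) auto
    also have "\<dots> = - y / (1 + y)" using pos by (simp add: field_simps)
    also have "\<dots> \<le> \<bar>y\<bar> / (3 / 4)" using y14 by (intro frac_le) auto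
    finally show ?thesis using False by simp
  qed
  then have "(r / 2)\<^sup>2 \<le> (4 / 3 * y)\<^sup>2" by (simp add: abs_le_square_iff[symmetric] abs_mult)
  then have "r\<^sup>2 \<le> 64 / 9 * y\<^sup>2" by (simp add: power2_eq_square)
  also have "\<dots> \<le> 8 * Upsilon r" using y Upsilon_nonneg[of r] by simp
  finally show ?thesis .
qed

text \<open>This is \<open>4 sinh\<^sup>2 (w / 4)\<close>. It bounds \<open>exp (- w / 2) * Upsilon w\<close> from below and captures both of its
  regimes: quadratic at \<open>0\<close>, exponential at \<open>\<infinity>\<close>.\<close>

definition sinh_sq :: "real \<Rightarrow> real" where
  "sinh_sq w = (exp (w / 4) - exp (- w / 4))\<^sup>2"

lemma sinh_sq_nonneg: "0 \<le> sinh_sq w"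
  by (simp add: sinh_sq_def)

text \<open>The double sum for \<open>2 \<Psi>\<^sub>2\<^sub>,\<^sub>\<Upsilon>\<close> contains the same value \<open>Upsilon w\<close> twice, at the index pairs \<open>(n, - n)\<close> and
  \<open>(- n, n)\<close>, with weights \<open>exp a\<close> and \<open>exp b\<close> whose product is \<open>exp (- w)\<close>. The arithmetic-geometric mean
  inequality replaces the unknown weights by \<open>2 exp (- w / 2)\<close>. The factor \<open>exp (- w / 2)\<close> does not destroy
  the growth of \<open>Upsilon\<close>, because \<open>Upsilon w \<ge> (exp (w / 2) - 1)\<^sup>2\<close>.\<close>

lemma sinh_sq_le_Upsilon:
  assumes "a + b = - w"
  shows "2 * sinh_sq w \<le> (exp a + exp b) * Upsilon w"
proof -
  have "0 \<le> (exp (a / 2) - exp (b / 2))\<^sup>2" by simp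
  also have "\<dots> = exp a + exp b - 2 * exp (- w / 2)"
    using assms by (simp add: power2_eq_square algebra_simps flip: exp_add add_divide_distrib)
  finally have amgm: "2 * exp (- w / 2) \<le> exp a + exp b" by simp
  have "sinh_sq w = exp (- w / 2) * (exp (w / 2) - 1)\<^sup>2"
    unfolding sinh_sq_def by (simp add: power2_eq_square algebra_simps flip: exp_add)
  also have "\<dots> \<le> exp (- w / 2) * Upsilon w"
    by (intro mult_left_mono Upsilon_ge_square) simp
  finally have "2 * sinh_sq w \<le> (2 * exp (- w / 2)) * Upsilon w" by simp
  also have "\<dots> \<le> (exp a + exp b) * Upsilon w"
    by (intro mult_right_mono amgm Upsilon_nonneg)
  finally show ?thesis .
qed

lemma sinh_sq_ge_exp:
  assumes "0 \<le> w"
  shows "(exp (w / 4) - 1)\<^sup>2 \<le> sinh_sq w"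
  unfolding sinh_sq_def using assms by (intro power_mono) auto

lemma sinh_sq_ge_power:
  assumes "0 \<le> w" "1 \<le> m"
  shows "w ^ (2 * m) \<le> (4 ^ m * fact m)\<^sup>2 * sinh_sq w"
proof -
  define t where "t = w / 4"
  have t: "0 \<le> t" using assms by (simp add: t_def)
  have "t ^ m / fact m \<le> exp t - exp (- t)"
  proof -
    have "(\<lambda>n. inverse (fact n) * t ^ n) sums exp t"
      using exp_converges[of t] by simp
    then have "(\<Sum>n\<in>{0, m}. inverse (fact n) * t ^ n) \<le> exp t"
      using t sum_le_suminf[of "\<lambda>n. inverse (fact n) * t ^ n" "{0, m}"]
      by (auto simp: sums_iff)
    then have "1 + t ^ m / fact m \<le> exp t" using assms by (simp add: field_simps)
    moreover have "exp (- t) \<le> 1" using t by simp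
    ultimately show ?thesis by linarith
  qed
  then have "(t ^ m / fact m)\<^sup>2 \<le> sinh_sq w"
    unfolding sinh_sq_def t_def[symmetric] using t
    by (metis divide_nonneg_nonneg fact_ge_zero minus_divide_left power_mono t_def zero_le_power)
  moreover have "w ^ (2 * m) = (4 ^ m * fact m)\<^sup>2 * (t ^ m / fact m)\<^sup>2"
    by (simp add: t_def power_mult_distrib power_divide power_mult power2_eq_square mult_2 power_add)
  ultimately show ?thesis by (simp add: mult_left_mono)
qed

text \<open>A linear functional of \<open>w\<close> is to be bounded by \<open>sinh_sq\<close>. Below a freely chosen threshold \<open>\<tau>\<close> there is
  nothing to do, and above it \<open>r\<close> is at most \<open>r ^ (2 m) / \<tau> ^ (2 m - 1)\<close>.\<close>

lemma le_threshold_plus_sinh_sq: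
  assumes "1 \<le> m" "0 < \<tau>"
  shows "r \<le> \<tau> + (4 ^ m * fact m)\<^sup>2 * sinh_sq r / \<tau> ^ (2 * m - 1)"
proof (cases "r \<le> \<tau>")
  case True
  have "0 \<le> (4 ^ m * fact m)\<^sup>2 * sinh_sq r / \<tau> ^ (2 * m - 1)"
    using assms by (intro divide_nonneg_pos mult_nonneg_nonneg sinh_sq_nonneg) auto
  with True show ?thesis by linarith
next
  case False
  have m: "2 * m = Suc (2 * m - 1)" using assms(1) by simp
  have "r * \<tau> ^ (2 * m - 1) \<le> r * r ^ (2 * m - 1)"
    using False assms by (intro mult_left_mono power_mono) auto
  also have "\<dots> = r ^ (2 * m)" by (subst m) simp
  also have "\<dots> \<le> (4 ^ m * fact m)\<^sup>2 * sinh_sq r"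
    using False assms by (intro sinh_sq_ge_power) auto
  finally have "r \<le> (4 ^ m * fact m)\<^sup>2 * sinh_sq r / \<tau> ^ (2 * m - 1)"
    using assms by (simp add: field_simps)
  then show ?thesis using assms by simp
qed

section \<open>Sums of powers\<close>

lemma powr_diff_mvt:
  assumes "0 < x" "x < (y::real)"
  obtains z where "x < z" "z < y" "y powr q - x powr q = (y - x) * (q * z powr (q - 1))"
proof -
  have "\<exists>z>x. z < y \<and> y powr q - x powr q = (y - x) * (q * z powr (q - 1))"
    by (rule MVT2) (use assms in \<open>auto intro!: derivative_eq_intros\<close>)
  then show ?thesis using that by blast
qed

lemma sum_powr_tail_le:
  assumes "0 < \<gamma>" "1 \<le> M"
  shows "(\<Sum>n\<in>{M<..N}. real n powr (- 1 - \<gamma>)) \<le> real M powr (- \<gamma>) / \<gamma>"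
proof -
  have decrease: "real (Suc n) powr (- 1 - \<gamma>) \<le> (real n powr - \<gamma> - real (Suc n) powr - \<gamma>) / \<gamma>"
    if "1 \<le> n" for n
  proof -
    obtain z where z: "real n < z" "z < real (Suc n)"
      "real (Suc n) powr (- \<gamma>) - real n powr (- \<gamma>)
         = (real (Suc n) - real n) * (- \<gamma> * z powr (- \<gamma> - 1))"
      by (rule powr_diff_mvt[of "real n" "real (Suc n)" "- \<gamma>"]) (use \<open>1 \<le> n\<close> in auto)
    then have "(real n powr - \<gamma> - real (Suc n) powr - \<gamma>) / \<gamma> = z powr (- \<gamma> - 1)"
      using assms by (simp add: field_simps)
    moreover have "real (Suc n) powr (- 1 - \<gamma>) \<le> z powr (- 1 - \<gamma>)"
      using z that assms by (intro powr_mono2') auto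
    ultimately show ?thesis by (simp add: minus_diff_commute[of \<gamma> 1])
  qed
  show ?thesis
  proof (cases "M \<le> N")
    case True
    then have "(\<Sum>n\<in>{M<..N}. real n powr (- 1 - \<gamma>)) \<le> (real M powr - \<gamma> - real N powr - \<gamma>) / \<gamma>"
    proof (induction N rule: dec_induct)
      case (step n)
      have "{M<..Suc n} = insert (Suc n) {M<..n}" using step by auto
      then show ?case
        using step.IH step.hyps assms decrease[of n] by (simp add: diff_divide_distrib)
    qed simp
    also have "\<dots> \<le> real M powr - \<gamma> / \<gamma>" using assms by (simp add: divide_right_mono)
    finally show ?thesis .
  qed (use assms in simp)
qed

lemma sum_powr_le:
  assumes "0 < \<gamma>"
  shows "(\<Sum>n=1..N. real n powr (- 1 - \<gamma>)) \<le> 1 + 1 / \<gamma>"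
proof (cases "1 \<le> N")
  case True
  then have "{1..N} = insert 1 {1<..N}" by auto
  then show ?thesis using sum_powr_tail_le[OF assms, of 1 N] by simp
qed (use assms in simp)

lemma sum_powr_head_le:
  assumes "0 \<le> \<alpha>" "\<alpha> < 1"
  shows "(\<Sum>n=1..N. real n powr (- \<alpha>)) \<le> real N powr (1 - \<alpha>) / (1 - \<alpha>)"
proof (induction N)
  case (Suc n)
  have "real (Suc n) powr (- \<alpha>) \<le> (real (Suc n) powr (1 - \<alpha>) - real n powr (1 - \<alpha>)) / (1 - \<alpha>)"
  proof (cases "n = 0")
    case True
    then show ?thesis using assms by simp
  next
    case False
    obtain z where z: "real n < z" "z < real (Suc n)"
      "real (Suc n) powr (1 - \<alpha>) - real n powr (1 - \<alpha>)
         = (real (Suc n) - real n) * ((1 - \<alpha>) * z powr (1 - \<alpha> - 1))"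
      by (rule powr_diff_mvt[of "real n" "real (Suc n)" "1 - \<alpha>"]) (use False in auto)
    then have "(real (Suc n) powr (1 - \<alpha>) - real n powr (1 - \<alpha>)) / (1 - \<alpha>) = z powr (- \<alpha>)"
      using assms by (simp add: field_simps)
    moreover have "real (Suc n) powr (- \<alpha>) \<le> z powr (- \<alpha>)"
      using z False assms by (intro powr_mono2') auto
    ultimately show ?thesis by simp
  qed
  then show ?case using Suc by (simp add: diff_divide_distrib)
qed simp

lemma obtain_nat_between:
  assumes "1 \<le> (X::real)"
  obtains M :: nat where "1 \<le> M" "X \<le> real M" "real M \<le> 2 * X"
proof
  show "1 \<le> nat \<lceil>X\<rceil>" "X \<le> real (nat \<lceil>X\<rceil>)" "real (nat \<lceil>X\<rceil>) \<le> 2 * X"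
    using assms by linarith+
qed

section \<open>Symmetric integer intervals\<close>

lemma finite_subset_symmetric_interval:
  assumes "finite (Y :: int set)"
  obtains N where "Y \<subseteq> {- int N..int N}"
proof -
  obtain N where N: "\<And>y. y \<in> Y \<Longrightarrow> nat \<bar>y\<bar> \<le> N"
    using assms finite_nat_set_iff_bounded_le[of "(\<lambda>y. nat \<bar>y\<bar>) ` Y"] by auto
  have "Y \<subseteq> {- int N..int N}"
  proof
    fix y assume "y \<in> Y"
    with N[of y] show "y \<in> {- int N..int N}" by auto
  qed
  then show ?thesis by (rule that)
qed

lemma sum_symmetric_interval:
  fixes f :: "int \<Rightarrow> real"
  shows "sum f {- int N..int N} = f 0 + (\<Sum>n=1..N. f (int n) + f (- int n))"
proof (induction N)
  case (Suc N)
  have "{- int (Suc N)..int (Suc N)} = insert (int (Suc N)) (insert (- int (Suc N)) {- int N..int N})"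
    by auto
  then show ?case using Suc by simp
qed simp

section \<open>Two-sided bounds for the fractional kernel\<close>

lemma not_nonpos_Ints_minus:
  assumes "0 < b" "b < (1::real)"
  shows "- b \<notin> \<int>\<^sub>\<le>\<^sub>0"
proof
  assume "- b \<in> \<int>\<^sub>\<le>\<^sub>0"
  then obtain n where "- b = - of_nat n" by (elim nonpos_Ints_cases')
  then show False using assms by (cases n) auto
qed

text \<open>Both Gamma values are Pochhammer symbols \<open>z (z + 1) \<dots> (z + n - 1)\<close>, up to a constant, with \<open>z = - b\<close>
  and \<open>z = 1 + b\<close>, so Euler's limit formula for \<open>Gamma\<close> gives their growth.\<close>

lemma Gamma_quotient_tendsto:
  assumes "0 < b" "b < (1::real)"
  shows "(\<lambda>n. Gamma (real n - b) / Gamma (real n + 1 + b) * real n powr (1 + 2 * b)) \<longlonglongrightarrow> 1"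
proof -
  have z1: "- b \<notin> \<int>\<^sub>\<le>\<^sub>0" using not_nonpos_Ints_minus[OF assms] .
  have z2: "1 + b \<notin> \<int>\<^sub>\<le>\<^sub>0" using assms by (auto elim!: nonpos_Ints_cases')
  have G1: "Gamma (- b) \<noteq> 0" using z1 by (simp add: Gamma_eq_zero_iff)
  have G2: "Gamma (1 + b) \<noteq> 0" using z2 by (simp add: Gamma_eq_zero_iff)
  have "(\<lambda>n. Gamma (- b) / Gamma_series' (- b) n * (Gamma_series' (1 + b) n / Gamma (1 + b)))
          \<longlonglongrightarrow> Gamma (- b) / Gamma (- b) * (Gamma (1 + b) / Gamma (1 + b))"
    by (intro tendsto_intros Gamma_series'_LIMSEQ) (use G1 G2 in auto)
  then have lim: "(\<lambda>n. Gamma (- b) / Gamma_series' (- b) n * (Gamma_series' (1 + b) n / Gamma (1 + b)))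
          \<longlonglongrightarrow> 1" using G1 G2 by simp
  have "Gamma (- b) / Gamma_series' (- b) n * (Gamma_series' (1 + b) n / Gamma (1 + b))
          = Gamma (real n - b) / Gamma (real n + 1 + b) * real n powr (1 + 2 * b)"
    if "0 < n" for n
  proof -
    have p1: "pochhammer (- b) n = Gamma (real n - b) / Gamma (- b)"
      using pochhammer_Gamma[OF z1, of n] by (simp add: add.commute)
    have p2: "pochhammer (1 + b) n = Gamma (real n + 1 + b) / Gamma (1 + b)"
      using pochhammer_Gamma[OF z2, of n] by (simp add: add_ac)
    have n1: "Gamma (real n - b) > 0" "Gamma (real n + 1 + b) > 0"
      using that assms by (auto intro!: Gamma_real_pos)
    have e: "real n powr (1 + 2 * b) = exp ((1 + b) * ln (real n)) / exp (- b * ln (real n))"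
      using that by (simp add: powr_def algebra_simps flip: exp_diff exp_add)
    show ?thesis
      unfolding Gamma_series'_def p1 p2 e using n1 G1 G2
      by (simp add: field_simps)
  qed
  then show ?thesis
    by (intro Lim_transform_eventually[OF lim] eventually_mono[OF eventually_gt_at_top[of 0]]) auto
qed

lemma positive_sequence_two_sided_bound:
  assumes "f \<longlonglongrightarrow> L" "0 < (L::real)" "\<And>n. 1 \<le> n \<Longrightarrow> 0 < f n"
  obtains c C where "0 < c" "\<And>n. 1 \<le> n \<Longrightarrow> c \<le> f n" "\<And>n. 1 \<le> n \<Longrightarrow> f n \<le> C"
proof -
  have "eventually (\<lambda>n. L / 2 < f n \<and> f n < 2 * L) sequentially"
    using assms(2) by (intro eventually_conj order_tendstoD[OF assms(1)]) auto
  then obtain N where N: "\<And>n. n \<ge> N \<Longrightarrow> L / 2 < f n \<and> f n < 2 * L"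
    by (auto simp: eventually_sequentially)
  define S where "S = f ` {1..N}"
  have "finite S" by (simp add: S_def)
  define c where "c = Min (insert (L / 2) S)"
  define C where "C = Max (insert (2 * L) S)"
  have "0 < c" using assms \<open>finite S\<close> by (auto simp: c_def S_def)
  moreover have "c \<le> f n" "f n \<le> C" if "1 \<le> n" for n
  proof -
    have "c \<le> f n \<and> f n \<le> C"
    proof (cases "n \<le> N")
      case True
      then have "f n \<in> insert (L / 2) S" "f n \<in> insert (2 * L) S" using that by (auto simp: S_def)
      then show ?thesis using \<open>finite S\<close> by (auto simp: c_def C_def)
    next
      case False
      then have "L / 2 < f n" "f n < 2 * L" using N by auto
      moreover have "c \<le> L / 2" "2 * L \<le> C" using \<open>finite S\<close> unfolding c_def C_def
        by (intro Min_le Max_ge; simp)+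
      ultimately show ?thesis by linarith
    qed
    then show "c \<le> f n" "f n \<le> C" by auto
  qed
  ultimately show ?thesis using that by blast
qed

lemma frac_kernel_bounds:
  assumes "0 < \<beta>" "\<beta> < 2"
  obtains c C where "0 < c"
    "\<And>n. 1 \<le> n \<Longrightarrow> c * real n powr (- 1 - \<beta>) \<le> frac_kernel \<beta> (int n)"
    "\<And>n. 1 \<le> n \<Longrightarrow> frac_kernel \<beta> (int n) \<le> C * real n powr (- 1 - \<beta>)"
proof -
  define b where "b = \<beta> / 2"
  have b: "0 < b" "b < 1" using assms by (auto simp: b_def)
  define K where "K = 4 powr (\<beta> / 2) * Gamma ((1 + \<beta>) / 2) / (sqrt pi * \<bar>Gamma (- (\<beta> / 2))\<bar>)"
  have "Gamma (- b) \<noteq> 0" using not_nonpos_Ints_minus[OF b] by (simp add: Gamma_eq_zero_iff)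
  then have K: "0 < K" unfolding K_def using assms
    by (intro divide_pos_pos mult_pos_pos Gamma_real_pos) (auto simp: b_def)
  define f where "f n = Gamma (real n - b) / Gamma (real n + 1 + b) * real n powr (1 + 2 * b)" for n
  have "f n > 0" if "1 \<le> n" for n
    unfolding f_def using that b by (intro mult_pos_pos divide_pos_pos Gamma_real_pos) auto
  with Gamma_quotient_tendsto[OF b] obtain c C where
    cC: "0 < c" "\<And>n. 1 \<le> n \<Longrightarrow> c \<le> f n" "\<And>n. 1 \<le> n \<Longrightarrow> f n \<le> C"
    using positive_sequence_two_sided_bound[of f 1] unfolding f_def by auto
  have eq: "frac_kernel \<beta> (int n) = K * f n * real n powr (- 1 - \<beta>)" if "1 \<le> n" for n
  proof -
    have "real n powr (1 + 2 * b) * real n powr (- 1 - \<beta>) = 1"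
      using that by (simp add: b_def flip: powr_add)
    then have "f n * real n powr (- 1 - \<beta>) = Gamma (real n - b) / Gamma (real n + 1 + b)"
      unfolding f_def by (simp add: mult.assoc)
    then show ?thesis using that unfolding frac_kernel_def K_def b_def by (simp add: mult.assoc)
  qed
  show ?thesis
  proof
    show "0 < K * c" using K cC by simp
    show "K * c * real n powr (- 1 - \<beta>) \<le> frac_kernel \<beta> (int n)" if "1 \<le> n" for n
      unfolding eq[OF that] using K cC that by (intro mult_right_mono mult_left_mono) auto
    show "frac_kernel \<beta> (int n) \<le> K * C * real n powr (- 1 - \<beta>)" if "1 \<le> n" for n
      unfolding eq[OF that] using K cC that by (intro mult_right_mono mult_left_mono) auto
  qed
qed

section \<open>The curvature operator as a double sum of squares\<close>

locale symmetric_kernel =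
  fixes k :: "int \<Rightarrow> real"
  assumes nonneg: "0 \<le> k j"
    and sym: "k (- j) = k j"
    and summable: "k summable_on UNIV"
begin

lemma summable_on_bounded_weight:
  assumes "\<And>j. \<bar>g j\<bar> \<le> B"
  shows "(\<lambda>j. k j * g j) summable_on UNIV"
proof -
  have "(\<lambda>j. norm (k j * g j)) summable_on UNIV"
  proof (rule Infinite_Sum.abs_summable_on_comparison_test')
    show "(\<lambda>j. k j * B) summable_on UNIV" by (intro summable_on_cmult_left summable)
    show "norm (k j * g j) \<le> k j * B" for j
      using assms[of j] nonneg[of j] by (simp add: abs_mult mult_left_mono)
  qed
  then show ?thesis by (rule abs_summable_summable)
qed

lemma summable_on_bounded_weight2:
  assumes "\<And>j l. \<bar>T j l\<bar> \<le> B"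
  shows "(\<lambda>(j, l). k j * k l * T j l) summable_on UNIV"
proof -
  define S where "S = infsum k UNIV"
  have "(\<lambda>p. norm (case p of (j, l) \<Rightarrow> k j * k l * T j l)) summable_on UNIV \<times> UNIV"
  proof (rule Infinite_Sum.abs_summable_on_comparison_test')
    show "(\<lambda>(j, l). k j * (k l * B)) summable_on UNIV \<times> UNIV"
    proof (rule summable_on_SigmaI[where g = "\<lambda>j. k j * (S * B)"])
      show "((\<lambda>y. case (x, y) of (j, l) \<Rightarrow> k j * (k l * B)) has_sum k x * (S * B)) UNIV" for x
        unfolding S_def prod.case using summable
        by (intro has_sum_cmult_right has_sum_cmult_left has_sum_infsum)
      show "(\<lambda>j. k j * (S * B)) summable_on UNIV" by (intro summable_on_cmult_left summable)
      have "0 \<le> B" using assms[of 0 0] by linarith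
      then show "0 \<le> (case (x, y) of (j, l) \<Rightarrow> k j * (k l * B))" for x y
        using nonneg by simp
    qed
    show "norm (case p of (j, l) \<Rightarrow> k j * k l * T j l) \<le> (case p of (j, l) \<Rightarrow> k j * (k l * B))"
      for p
    proof (cases p)
      case (Pair j l)
      have "k j * k l * \<bar>T j l\<bar> \<le> k j * k l * B"
        using assms[of j l] nonneg[of j] nonneg[of l] by (intro mult_left_mono) auto
      then show ?thesis
        using nonneg[of j] nonneg[of l] by (simp add: Pair abs_mult mult.assoc)
    qed
  qed
  from abs_summable_summable[OF this] show ?thesis by simp
qed

lemma infsum_iterated:
  assumes "\<And>j l. \<bar>T j l\<bar> \<le> B"
  shows "(\<Sum>\<^sub>\<infinity>j. k j * (\<Sum>\<^sub>\<infinity>l. k l * T j l)) = (\<Sum>\<^sub>\<infinity>(j, l). k j * k l * T j l)"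
proof -
  have "(\<Sum>\<^sub>\<infinity>j. k j * (\<Sum>\<^sub>\<infinity>l. k l * T j l)) = (\<Sum>\<^sub>\<infinity>j. \<Sum>\<^sub>\<infinity>l. k j * k l * T j l)"
  proof (intro infsum_cong)
    fix j
    have "(\<lambda>l. k l * T j l) summable_on UNIV" using assms by (intro summable_on_bounded_weight)
    then show "k j * (\<Sum>\<^sub>\<infinity>l. k l * T j l) = (\<Sum>\<^sub>\<infinity>l. k j * k l * T j l)"
      by (simp add: infsum_cmult_right mult.assoc)
  qed
  also have "\<dots> = (\<Sum>\<^sub>\<infinity>(j, l). k j * k l * T j l)"
    using summable_on_bounded_weight2[OF assms] infsum_Sigma'_banach[of "\<lambda>j l. k j * k l * T j l" UNIV "\<lambda>_. UNIV"]
    by simp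
  finally show ?thesis .
qed

lemma infsum_weight_diff:
  assumes "\<And>j. \<bar>g j\<bar> \<le> B" "\<And>j. \<bar>h j\<bar> \<le> B"
  shows "(\<Sum>\<^sub>\<infinity>j. k j * g j) - (\<Sum>\<^sub>\<infinity>j. k j * h j) = (\<Sum>\<^sub>\<infinity>j. k j * (g j - h j))"
proof -
  have "((\<lambda>j. k j * g j + (- 1) * (k j * h j)) has_sum
      (\<Sum>\<^sub>\<infinity>j. k j * g j) + (- 1) * (\<Sum>\<^sub>\<infinity>j. k j * h j)) UNIV"
    by (intro has_sum_add has_sum_cmult_right has_sum_infsum
        summable_on_bounded_weight[OF assms(1)] summable_on_bounded_weight[OF assms(2)])
  from infsumI[OF this] show ?thesis by (simp add: right_diff_distrib)
qed

lemma infsum_convolution_form: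
  "(\<Sum>\<^sub>\<infinity>y\<in>UNIV. k (x - y) * g y) = (\<Sum>\<^sub>\<infinity>j\<in>UNIV. k j * g (x + j))"
proof -
  have "bij_betw (\<lambda>j. x + j) UNIV (UNIV :: int set)"
    by (rule bij_betwI[of _ _ _ "\<lambda>y. y - x"]) auto
  then have "(\<Sum>\<^sub>\<infinity>y\<in>UNIV. k (x - y) * g y) = (\<Sum>\<^sub>\<infinity>j\<in>UNIV. k (x - (x + j)) * g (x + j))"
    by (rule infsum_reindex_bij_betw[symmetric])
  then show ?thesis by (simp add: sym)
qed

end

text \<open>The mixed second difference of \<open>u\<close> at \<open>x\<close>. The choice \<open>l = - j\<close> gives \<open>2 u x - u (x + j) - u (x - j)\<close>, the
  negative of the usual centred second difference.\<close>

definition second_diff :: "(int \<Rightarrow> real) \<Rightarrow> int \<Rightarrow> int \<Rightarrow> int \<Rightarrow> real" where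
  "second_diff u x j l = u (x + j + l) - u (x + j) - u (x + l) + u x"

lemma abs_diff_le_double: "\<bar>a\<bar> \<le> c \<Longrightarrow> \<bar>b\<bar> \<le> c \<Longrightarrow> \<bar>a - b\<bar> \<le> 2 * c" for a b c :: real
  by linarith

context symmetric_kernel
begin

text \<open>Write \<open>a\<close>, \<open>b\<close>, \<open>c\<close> for the increments of \<open>u\<close> from \<open>x\<close> to \<open>x + j\<close>, \<open>x + l\<close>, \<open>x + j + l\<close>. The summand of
  \<open>L \<Psi>\<^sub>\<Upsilon> - B\<^sub>\<Upsilon>\<^sub>'\<close> at \<open>(j, l)\<close> is \<open>exp (c - a) - exp b - exp a * (c - a - b)\<close>. Since \<open>c - a - b\<close> and the weight
  \<open>k j * k l\<close> are symmetric in \<open>j\<close> and \<open>l\<close>, the factor \<open>exp a\<close> may be exchanged for \<open>exp b\<close> under the sum, and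
  then the summand equals \<open>exp b * Upsilon (c - a - b)\<close>, which is nonnegative.\<close>

theorem has_sum_Psi2:
  assumes "bounded (range u)"
  shows "((\<lambda>(j, l). k j * k l * (exp (u (x + l) - u x) * Upsilon (second_diff u x j l)))
           has_sum 2 * Psi2_Upsilon k u x) UNIV"
proof -
  obtain B where B: "\<bar>u y\<bar> \<le> B" for y
    using assms unfolding bounded_iff by auto
  have d: "\<bar>u y - u z\<bar> \<le> 2 * B" for y z using B[of y] B[of z] by linarith
  define E where "E = exp (2 * B)"
  have e: "exp (u y - u z) \<le> E" for y z using d[of y z] by (simp add: E_def)
  have E0: "0 \<le> E" by (simp add: E_def)
  have sd: "\<bar>second_diff u x j l\<bar> \<le> 4 * B" for j l
    unfolding second_diff_def
    using B[of "x + j + l"] B[of "x + j"] B[of "x + l"] B[of x] by linarith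
  have Ub1: "Upsilon (u y - u z) \<le> E + 2 * B" for y z
    using e[of y z] d[of y z] unfolding Upsilon_def by linarith
  then have Ub: "\<bar>Upsilon (u y - u z)\<bar> \<le> E + 2 * B" for y z
    using Upsilon_nonneg[of "u y - u z"] by simp
  \<comment> \<open>the inner summands of \<open>L \<Psi>\<^sub>\<Upsilon>\<close> and of \<open>B\<^sub>\<Upsilon>\<^sub>'(u, L u)\<close>\<close>
  define T1 where "T1 j l = Upsilon (u (x + j + l) - u (x + j)) - Upsilon (u (x + l) - u x)" for j l
  define T2 where "T2 j l = (exp (u (x + j) - u x) - 1) * second_diff u x j l" for j l
  have T1b: "\<bar>T1 j l\<bar> \<le> 2 * (E + 2 * B)" for j l
    unfolding T1_def by (intro abs_diff_le_double Ub)
  have T2b: "\<bar>T2 j l\<bar> \<le> (E + 1) * (4 * B)" for j l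
  proof -
    have "\<bar>exp (u (x + j) - u x) - 1\<bar> \<le> E + 1"
      using e[of "x + j" x] exp_gt_zero[of "u (x + j) - u x"] by linarith
    then show ?thesis unfolding T2_def abs_mult using E0 by (intro mult_mono sd) auto
  qed
  have Psi: "Psi_Upsilon k u y = (\<Sum>\<^sub>\<infinity>l. k l * Upsilon (u (y + l) - u y))" for y
    unfolding Psi_Upsilon_def by (rule infsum_convolution_form)
  have L1: "gen_op k (Psi_Upsilon k u) x = (\<Sum>\<^sub>\<infinity>(j, l). k j * k l * T1 j l)"
  proof -
    have "gen_op k (Psi_Upsilon k u) x = (\<Sum>\<^sub>\<infinity>j. k j * (\<Sum>\<^sub>\<infinity>l. k l * T1 j l))"
      unfolding gen_op_def
    proof (intro infsum_cong)
      fix j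
      show "k j * (Psi_Upsilon k u (x + j) - Psi_Upsilon k u x) = k j * (\<Sum>\<^sub>\<infinity>l. k l * T1 j l)"
        unfolding Psi T1_def by (subst infsum_weight_diff[OF Ub Ub]) (rule refl)
    qed
    then show ?thesis by (simp add: infsum_iterated[OF T1b])
  qed
  have L2: "B_Upsilon' k u (gen_op k u) x = (\<Sum>\<^sub>\<infinity>(j, l). k j * k l * T2 j l)"
  proof -
    have "B_Upsilon' k u (gen_op k u) x
        = (\<Sum>\<^sub>\<infinity>j. k j * ((exp (u (x + j) - u x) - 1) * (gen_op k u (x + j) - gen_op k u x)))"
      unfolding B_Upsilon'_def deriv_Upsilon mult.assoc by (rule infsum_convolution_form)
    also have "\<dots> = (\<Sum>\<^sub>\<infinity>j. k j * (\<Sum>\<^sub>\<infinity>l. k l * T2 j l))"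
    proof (intro infsum_cong)
      fix j
      have "gen_op k u (x + j) - gen_op k u x = (\<Sum>\<^sub>\<infinity>l. k l * second_diff u x j l)"
        unfolding gen_op_def second_diff_def
        by (subst infsum_weight_diff[OF d d]) (simp add: algebra_simps)
      moreover have "(\<Sum>\<^sub>\<infinity>l. k l * T2 j l)
          = (exp (u (x + j) - u x) - 1) * (\<Sum>\<^sub>\<infinity>l. k l * second_diff u x j l)"
        unfolding T2_def
        by (subst infsum_cmult_right[symmetric])
          (auto intro: summable_on_bounded_weight[OF sd] simp: mult_ac)
      ultimately show "k j * ((exp (u (x + j) - u x) - 1) * (gen_op k u (x + j) - gen_op k u x))
          = k j * (\<Sum>\<^sub>\<infinity>l. k l * T2 j l)" by simp
    qed
    finally show ?thesis by (simp add: infsum_iterated[OF T2b])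
  qed
  \<comment> \<open>Moving the factor \<open>exp (u (x + j) - u x)\<close> to the other index is what turns the
    difference into a sum of nonnegative terms.\<close>
  define T3 where "T3 j l = exp (u (x + j) - u x) * second_diff u x j l" for j l
  have T3b: "\<bar>T3 j l\<bar> \<le> E * (4 * B)" for j l
    unfolding T3_def abs_mult using e[of "x + j" x] E0 by (intro mult_mono sd) auto
  have hs: "((\<lambda>(j, l). k j * k l * T j l) has_sum (\<Sum>\<^sub>\<infinity>(j, l). k j * k l * T j l)) UNIV"
    if "\<And>j l. \<bar>T j l\<bar> \<le> C" for T C
    using summable_on_bounded_weight2[OF that] by simp
  have hs1: "((\<lambda>(j, l). k j * k l * T1 j l) has_sum gen_op k (Psi_Upsilon k u) x) UNIV"
    unfolding L1 by (rule hs[OF T1b])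
  have hs2: "((\<lambda>(j, l). k j * k l * T2 j l) has_sum B_Upsilon' k u (gen_op k u) x) UNIV"
    unfolding L2 by (rule hs[OF T2b])
  define X where "X = (\<Sum>\<^sub>\<infinity>(j, l). k j * k l * T3 j l)"
  have hs3: "((\<lambda>(j, l). k j * k l * T3 j l) has_sum X) UNIV"
    unfolding X_def by (rule hs[OF T3b])
  then have hs3': "((\<lambda>(j, l). k l * k j * T3 l j) has_sum X) UNIV"
    using has_sum_reindex_bij_betw[of prod.swap UNIV UNIV "\<lambda>(j, l). k j * k l * T3 j l" X]
    by (simp add: case_prod_beta' bij_swap)
  have "((\<lambda>p. (case p of (j, l) \<Rightarrow> k j * k l * T1 j l) + ((case p of (j, l) \<Rightarrow> k j * k l * T3 j l)
      + ((- 1) * (case p of (j, l) \<Rightarrow> k j * k l * T2 j l)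
        + (- 1) * (case p of (j, l) \<Rightarrow> k l * k j * T3 l j))))
     has_sum gen_op k (Psi_Upsilon k u) x + (X + ((- 1) * B_Upsilon' k u (gen_op k u) x + (- 1) * X))) UNIV"
    by (intro has_sum_add has_sum_cmult_right hs1 hs2 hs3 hs3')
  moreover have "gen_op k (Psi_Upsilon k u) x + (X + ((- 1) * B_Upsilon' k u (gen_op k u) x + (- 1) * X))
      = 2 * Psi2_Upsilon k u x"
    unfolding Psi2_Upsilon_def by simp
  moreover have "k j * k l * T1 j l + (k j * k l * T3 j l
      + ((- 1) * (k j * k l * T2 j l) + (- 1) * (k l * k j * T3 l j)))
      = k j * k l * (exp (u (x + l) - u x) * Upsilon (second_diff u x j l))" for j l
  proof -
    have c: "second_diff u x l j = second_diff u x j l"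
      by (simp add: second_diff_def algebra_simps)
    have "exp (u (x + l) - u x) * exp (second_diff u x j l) = exp (u (x + j + l) - u (x + j))"
      by (simp add: second_diff_def flip: exp_add)
    then have collect: "T1 j l + T3 j l - T2 j l - T3 l j
        = exp (u (x + l) - u x) * Upsilon (second_diff u x j l)"
      unfolding T1_def T2_def T3_def c Upsilon_def
      by (simp add: algebra_simps) (simp add: second_diff_def algebra_simps)
    show ?thesis unfolding collect[symmetric] by (simp add: algebra_simps)
  qed
  ultimately show ?thesis by (simp add: case_prod_beta')
qed

lemma sum_le_Psi2:
  assumes "bounded (range u)" "finite S"
  shows "(\<Sum>(j, l)\<in>S. k j * k l * (exp (u (x + l) - u x) * Upsilon (second_diff u x j l)))
           \<le> 2 * Psi2_Upsilon k u x"
  using has_sum_Psi2[OF assms(1)] assms(2)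
  by (rule finite_sum_le_has_sum) (auto intro!: mult_nonneg_nonneg nonneg Upsilon_nonneg)

lemma Psi2_nonneg:
  assumes "bounded (range u)"
  shows "0 \<le> Psi2_Upsilon k u x"
  using sum_le_Psi2[OF assms, of "{}" x] by simp

text \<open>Pairing \<open>j\<close> with \<open>- j\<close> expresses \<open>- L u\<close> by the same second differences that occur on the antidiagonal
  of the double sum.\<close>

lemma gen_op_tendsto:
  assumes "bounded (range u)"
  shows "(\<lambda>N. \<Sum>n=1..N. k (int n) * second_diff u x (int n) (- int n)) \<longlonglongrightarrow> - gen_op k u x"
proof -
  obtain B where B: "\<bar>u y\<bar> \<le> B" for y
    using assms unfolding bounded_iff by auto
  have d: "\<bar>u y - u z\<bar> \<le> 2 * B" for y z using B[of y] B[of z] by linarith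
  define f where "f j = k j * (u (x + j) - u x)" for j
  have "(f has_sum gen_op k u x) UNIV"
    unfolding gen_op_def f_def using summable_on_bounded_weight[of "\<lambda>j. u (x + j) - u x" "2 * B"] d
    by simp
  then have lim: "(sum f \<longlongrightarrow> gen_op k u x) (finite_subsets_at_top UNIV)"
    by (simp add: has_sum_def)
  have "filterlim (\<lambda>N. {- int N..int N}) (finite_subsets_at_top UNIV) sequentially"
    unfolding filterlim_finite_subsets_at_top
  proof (intro allI impI)
    fix Y :: "int set" assume "finite Y \<and> Y \<subseteq> UNIV"
    then obtain N where N: "Y \<subseteq> {- int N..int N}"
      using finite_subset_symmetric_interval by blast
    have "Y \<subseteq> {- int n..int n}" if "N \<le> n" for n
      using N that by force
    then show "\<forall>\<^sub>F N in sequentially. finite {- int N..int N} \<and> Y \<subseteq> {- int N..int N} \<and> {- int N..int N} \<subseteq> UNIV"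
      by (intro eventually_mono[OF eventually_ge_at_top[of N]]) auto
  qed
  from filterlim_compose[OF lim this]
  have "(\<lambda>N. - sum f {- int N..int N}) \<longlonglongrightarrow> - gen_op k u x" by (intro tendsto_minus)
  moreover have "- sum f {- int N..int N} = (\<Sum>n=1..N. k (int n) * second_diff u x (int n) (- int n))" for N
  proof -
    have "- (f (int n) + f (- int n)) = k (int n) * second_diff u x (int n) (- int n)" for n
      using sym[of "int n"] unfolding f_def second_diff_def by (simp add: algebra_simps)
    then show ?thesis
      unfolding sum_symmetric_interval by (simp add: f_def flip: sum_negf)
  qed
  ultimately show ?thesis by simp
qed

lemma sum_sinh_sq_le_Psi2:
  assumes u: "bounded (range u)" and A: "finite A" "\<And>n. n \<in> A \<Longrightarrow> 1 \<le> n"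
  shows "(\<Sum>n\<in>A. (k (int n))\<^sup>2 * sinh_sq (second_diff u x (int n) (- int n))) \<le> Psi2_Upsilon k u x"
proof -
  define g where "g = (\<lambda>(j, l). k j * k l * (exp (u (x + l) - u x) * Upsilon (second_diff u x j l)))"
  define S where "S = (\<lambda>n. (int n, - int n)) ` A"
  define S' where "S' = (\<lambda>n. (- int n, int n)) ` A"
  have inj: "inj_on (\<lambda>n. (int n, - int n)) A" "inj_on (\<lambda>n. (- int n, int n)) A"
    by (auto simp: inj_on_def)
  have disj: "S \<inter> S' = {}"
  proof -
    have False if "n \<in> A" "m \<in> A" "int n = - int m" for n m
      using A(2)[OF that(1)] that by linarith
    then show ?thesis unfolding S_def S'_def by auto
  qed
  have "2 * (\<Sum>n\<in>A. (k (int n))\<^sup>2 * sinh_sq (second_diff u x (int n) (- int n)))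
      \<le> (\<Sum>n\<in>A. g (int n, - int n) + g (- int n, int n))"
    unfolding sum_distrib_left
  proof (rule sum_mono)
    fix n assume "n \<in> A"
    define w where "w = second_diff u x (int n) (- int n)"
    have w': "second_diff u x (- int n) (int n) = w"
      unfolding w_def second_diff_def by simp
    have "2 * sinh_sq w \<le> (exp (u (x - int n) - u x) + exp (u (x + int n) - u x)) * Upsilon w"
      by (rule sinh_sq_le_Upsilon) (simp add: w_def second_diff_def)
    then have "(k (int n))\<^sup>2 * (2 * sinh_sq w)
        \<le> (k (int n))\<^sup>2 * ((exp (u (x - int n) - u x) + exp (u (x + int n) - u x)) * Upsilon w)"
      by (intro mult_left_mono) auto
    then show "2 * ((k (int n))\<^sup>2 * sinh_sq (second_diff u x (int n) (- int n)))
        \<le> g (int n, - int n) + g (- int n, int n)"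
      unfolding g_def w_def[symmetric] by (simp add: w' sym power2_eq_square algebra_simps flip: w_def)
  qed
  also have "\<dots> = sum g (S \<union> S')"
    using disj A inj by (simp add: sum.union_disjoint sum.distrib S_def S'_def sum.reindex)
  also have "\<dots> \<le> 2 * Psi2_Upsilon k u x"
    unfolding g_def using A by (intro sum_le_Psi2[OF u]) (auto simp: S_def S'_def)
  finally show ?thesis by simp
qed

text \<open>The terms of the double sum with \<open>l = \<sigma>\<close>, for a nearest neighbour \<open>\<sigma>\<close> of the origin.\<close>

lemma sum_row_le_Psi2:
  assumes "bounded (range u)" "finite A" "\<sigma> = 1 \<or> \<sigma> = - 1"
  shows "k 1 * exp (u (x + \<sigma>) - u x) * (\<Sum>i\<in>A. k i * Upsilon (second_diff u x (\<sigma> * i) \<sigma>))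
           \<le> 2 * Psi2_Upsilon k u x"
proof -
  have inj: "inj_on (\<lambda>i. (\<sigma> * i, \<sigma>)) A" using assms(3) by (auto simp: inj_on_def)
  have k\<sigma>: "k \<sigma> = k 1" "k (\<sigma> * i) = k i" "k (i * \<sigma>) = k i" for i using assms(3) sym[of 1] sym[of i] by auto
  have "k 1 * exp (u (x + \<sigma>) - u x) * (\<Sum>i\<in>A. k i * Upsilon (second_diff u x (\<sigma> * i) \<sigma>))
      = (\<Sum>(j, l)\<in>(\<lambda>i. (\<sigma> * i, \<sigma>)) ` A.
          k j * k l * (exp (u (x + l) - u x) * Upsilon (second_diff u x j l)))"
    using inj by (simp add: sum.reindex sum_distrib_left k\<sigma> mult_ac)
  also have "\<dots> \<le> 2 * Psi2_Upsilon k u x"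
    using assms by (intro sum_le_Psi2) auto
  finally show ?thesis .
qed

end

section \<open>Coercivity estimates for power-law kernels\<close>

locale power_kernel = symmetric_kernel +
  fixes \<beta> c C :: real
  assumes \<beta>_pos: "0 < \<beta>" and c_pos: "0 < c"
    and lower: "1 \<le> n \<Longrightarrow> c * real n powr (- 1 - \<beta>) \<le> k (int n)"
    and upper: "1 \<le> n \<Longrightarrow> k (int n) \<le> C * real n powr (- 1 - \<beta>)"
begin

lemma k_pos: "1 \<le> n \<Longrightarrow> 0 < k (int n)"
  using lower[of n] c_pos by (smt (verit) mult_pos_pos of_nat_le_0_iff powr_gt_zero not_one_le_zero)

lemma c_le_k_1: "c \<le> k 1"
  using lower[of 1] by simp

lemma C_pos: "0 < C"
  using upper[of 1] k_pos[of 1] by simp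

abbreviation w :: "(int \<Rightarrow> real) \<Rightarrow> int \<Rightarrow> nat \<Rightarrow> real" where
  "w u x n \<equiv> second_diff u x (int n) (- int n)"

text \<open>A truncated duality inequality between \<open>\<Sum> k w\<close> and \<open>\<Sum> k\<^sup>2 sinh_sq w\<close>, with a free multiplier \<open>\<Lambda>\<close>. The
  threshold \<open>\<tau> = (\<Lambda> * k n) powr (- \<rho>)\<close> is chosen for each \<open>n\<close> so that the second term carries the weight
  \<open>\<Lambda> * (k n)\<^sup>2\<close>. For \<open>m = 1\<close> this corresponds to the Cauchy-Schwarz inequality and is used on finite ranges. A large \<open>m\<close> makes
  \<open>\<rho>\<close> small, so that \<open>\<Sum> k powr (1 - \<rho>)\<close> converges.\<close>

lemma weighted_sum_le:
  assumes u: "bounded (range u)" and A: "finite A" "\<And>n. n \<in> A \<Longrightarrow> 1 \<le> n"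
    and m: "1 \<le> m" and \<rho>: "\<rho> = 1 / (2 * real m - 1)" and \<Lambda>: "0 < \<Lambda>"
  shows "(\<Sum>n\<in>A. k (int n) * w u x n)
    \<le> \<Lambda> powr (- \<rho>) * (\<Sum>n\<in>A. k (int n) powr (1 - \<rho>))
       + (4 ^ m * fact m)\<^sup>2 * \<Lambda> * Psi2_Upsilon k u x"
proof -
  define c' :: real where "c' = (4 ^ m * fact m)\<^sup>2"
  have "(\<Sum>n\<in>A. k (int n) * w u x n)
      \<le> (\<Sum>n\<in>A. \<Lambda> powr (- \<rho>) * k (int n) powr (1 - \<rho>)
            + c' * \<Lambda> * ((k (int n))\<^sup>2 * sinh_sq (w u x n)))"
  proof (rule sum_mono)
    fix n assume "n \<in> A"
    then have n: "1 \<le> n" using A by auto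
    define \<kappa> where "\<kappa> = k (int n)"
    have \<kappa>: "0 < \<kappa>" using k_pos[OF n] by (simp add: \<kappa>_def)
    define \<tau> where "\<tau> = (\<Lambda> * \<kappa>) powr (- \<rho>)"
    have \<tau>: "0 < \<tau>" using \<kappa> \<Lambda> by (simp add: \<tau>_def)
    have mm: "real (2 * m - 1) = 2 * real m - 1" using m by (simp add: of_nat_diff)
    have "\<tau> ^ (2 * m - 1) = \<tau> powr real (2 * m - 1)" using \<tau> by (simp add: powr_realpow)
    also have "\<dots> = (\<Lambda> * \<kappa>) powr (- \<rho> * (2 * real m - 1))"
      unfolding \<tau>_def powr_powr mm ..
    also have "- \<rho> * (2 * real m - 1) = - 1" using m by (simp add: \<rho>)
    finally have \<tau>m: "\<tau> ^ (2 * m - 1) = 1 / (\<Lambda> * \<kappa>)"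
      using \<kappa> \<Lambda> by (simp add: powr_minus_divide)
    have "w u x n \<le> \<tau> + c' * sinh_sq (w u x n) / \<tau> ^ (2 * m - 1)"
      unfolding c'_def using le_threshold_plus_sinh_sq[OF m \<tau>] .
    then have "\<kappa> * w u x n \<le> \<kappa> * (\<tau> + c' * sinh_sq (w u x n) / \<tau> ^ (2 * m - 1))"
      using \<kappa> by (intro mult_left_mono) auto
    also have "\<dots> = \<kappa> * \<tau> + c' * \<Lambda> * (\<kappa>\<^sup>2 * sinh_sq (w u x n))"
      unfolding \<tau>m by (simp add: algebra_simps power2_eq_square)
    also have "\<kappa> * \<tau> = \<Lambda> powr (- \<rho>) * \<kappa> powr (1 - \<rho>)"
      using \<kappa> \<Lambda> unfolding \<tau>_def by (simp add: powr_mult powr_diff powr_minus field_simps)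
    finally show "k (int n) * w u x n \<le> \<Lambda> powr (- \<rho>) * k (int n) powr (1 - \<rho>)
            + c' * \<Lambda> * ((k (int n))\<^sup>2 * sinh_sq (w u x n))"
      unfolding \<kappa>_def .
  qed
  also have "\<dots> = \<Lambda> powr (- \<rho>) * (\<Sum>n\<in>A. k (int n) powr (1 - \<rho>))
      + c' * \<Lambda> * (\<Sum>n\<in>A. (k (int n))\<^sup>2 * sinh_sq (w u x n))"
    by (simp add: sum.distrib sum_distrib_left)
  also have "\<dots> \<le> \<Lambda> powr (- \<rho>) * (\<Sum>n\<in>A. k (int n) powr (1 - \<rho>))
      + c' * \<Lambda> * Psi2_Upsilon k u x"
    using sum_sinh_sq_le_Psi2[OF u A] \<Lambda> unfolding c'_def
    by (intro add_left_mono mult_left_mono) auto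
  finally show ?thesis unfolding c'_def .
qed

lemma tail_le:
  assumes u: "bounded (range u)" and M: "1 \<le> M"
    and m: "1 \<le> m" and \<rho>: "\<rho> = 1 / (2 * real m - 1)" and \<Lambda>: "0 < \<Lambda>"
    and \<gamma>: "\<gamma> = \<beta> - \<rho> * (1 + \<beta>)" "0 < \<gamma>"
  shows "(\<Sum>n\<in>{M<..N}. k (int n) * w u x n)
    \<le> \<Lambda> powr (- \<rho>) * (C powr (1 - \<rho>) / \<gamma> * real M powr (- \<gamma>))
       + (4 ^ m * fact m)\<^sup>2 * \<Lambda> * Psi2_Upsilon k u x"
proof -
  have "0 < \<rho>" using m by (simp add: \<rho>)
  have "\<rho> \<le> 1" using m by (simp add: \<rho>)
  have "(\<Sum>n\<in>{M<..N}. k (int n) powr (1 - \<rho>))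
      \<le> (\<Sum>n\<in>{M<..N}. C powr (1 - \<rho>) * real n powr (- 1 - \<gamma>))"
  proof (rule sum_mono)
    fix n assume "n \<in> {M<..N}"
    then have n: "1 \<le> n" using M by auto
    have "k (int n) powr (1 - \<rho>) \<le> (C * real n powr (- 1 - \<beta>)) powr (1 - \<rho>)"
      using upper[OF n] k_pos[OF n] \<open>\<rho> \<le> 1\<close> by (intro powr_mono2) auto
    also have "\<dots> = C powr (1 - \<rho>) * real n powr ((- 1 - \<beta>) * (1 - \<rho>))"
      using C_pos by (simp add: powr_mult powr_powr)
    also have "(- 1 - \<beta>) * (1 - \<rho>) = - 1 - \<gamma>" by (simp add: \<gamma>(1) algebra_simps)
    finally show "k (int n) powr (1 - \<rho>) \<le> C powr (1 - \<rho>) * real n powr (- 1 - \<gamma>)" .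
  qed
  also have "\<dots> \<le> C powr (1 - \<rho>) * (real M powr (- \<gamma>) / \<gamma>)"
    unfolding sum_distrib_left[symmetric]
    by (intro mult_left_mono sum_powr_tail_le \<gamma> M) simp
  finally have "\<Lambda> powr (- \<rho>) * (\<Sum>n\<in>{M<..N}. k (int n) powr (1 - \<rho>))
      \<le> \<Lambda> powr (- \<rho>) * (C powr (1 - \<rho>) / \<gamma> * real M powr (- \<gamma>))"
    by (intro mult_left_mono) auto
  then show ?thesis
    using weighted_sum_le[OF u _ _ m \<rho> \<Lambda>, of "{M<..N}" x] M by fastforce
qed

lemma minus_gen_op_le:
  assumes "bounded (range u)" "\<And>N. M \<le> N \<Longrightarrow> (\<Sum>n=1..N. k (int n) * w u x n) \<le> b"
  shows "- gen_op k u x \<le> b"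
  using gen_op_tendsto[OF assms(1), of x] assms(2) by (intro LIMSEQ_le_const2) blast+

lemma sum_split_at:
  fixes f :: "nat \<Rightarrow> real"
  assumes "(M::nat) \<le> N"
  shows "sum f {1..N} = sum f {1..M} + sum f {M<..N}"
proof -
  have "{1..N} = {1..M} \<union> {M<..N}" using assms by auto
  moreover have "{1..M} \<inter> {M<..N} = {}" by auto
  ultimately show ?thesis by (metis finite_atLeastAtMost finite_greaterThanAtMost sum.union_disjoint)
qed

subsection \<open>Polynomial lower bound\<close>

lemma ex_small_rho:
  assumes "0 < e"
  obtains m :: nat and \<rho> :: real where "1 \<le> m" "\<rho> = 1 / (2 * real m - 1)" "\<rho> * (1 + \<beta>) < e"
proof -
  obtain m :: nat where m: "real m > (1 + \<beta>) / e + 1" using reals_Archimedean2 by blast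
  have p: "0 < (1 + \<beta>) / e" using assms \<beta>_pos by simp
  have "(1 + \<beta>) / (2 * real m - 1) < e"
  proof -
    have "(1 + \<beta>) / e < 2 * real m - 1" using m p by linarith
    moreover from this have "0 < 2 * real m - 1" using p by linarith
    ultimately show ?thesis using assms by (simp add: pos_divide_less_eq mult.commute)
  qed
  moreover have "1 \<le> m" using m p by linarith
  ultimately show ?thesis using that[of m "1 / (2 * real m - 1)"] by simp
qed

text \<open>The scale \<open>M\<close> separates near and far jumps. With multiplier \<open>M powr (1 + \<beta>)\<close>, the threshold at
  \<open>n \<approx> M\<close> is of order \<open>1\<close>, and near and far jumps contribute equally, namely the mass \<open>M powr (- \<beta>)\<close> of the
  far jumps.\<close>

lemma minus_gen_op_le_scale:
  obtains K where "1 \<le> K"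
    "\<And>u x M. bounded (range u) \<Longrightarrow> 1 \<le> M \<Longrightarrow>
       - gen_op k u x \<le> K * real M powr (- \<beta>) + K * real M powr (1 + \<beta>) * Psi2_Upsilon k u x"
proof -
  obtain m \<rho> where m: "1 \<le> m" and \<rho>: "\<rho> = 1 / (2 * real m - 1)" "\<rho> * (1 + \<beta>) < \<beta>"
    using ex_small_rho[OF \<beta>_pos] by blast
  define \<gamma> where "\<gamma> = \<beta> - \<rho> * (1 + \<beta>)"
  have \<gamma>: "0 < \<gamma>" using \<rho> by (simp add: \<gamma>_def)
  define K where "K = 1 + C powr (1 - \<rho>) / \<gamma> + 16 + (4 ^ m * fact m)\<^sup>2"
  have K: "1 + C powr (1 - \<rho>) / \<gamma> \<le> K" "16 + (4 ^ m * fact m)\<^sup>2 \<le> K" "1 \<le> K"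
    using \<gamma> by (auto simp: K_def intro: add_nonneg_nonneg)
  show ?thesis
  proof
    show "1 \<le> K" by fact
    fix u :: "int \<Rightarrow> real" and x M assume u: "bounded (range u)" and M: "(1::nat) \<le> M"
    define \<Lambda> where "\<Lambda> = real M powr (1 + \<beta>)"
    define P where "P = Psi2_Upsilon k u x"
    have P: "0 \<le> P" unfolding P_def by (rule Psi2_nonneg[OF u])
    have \<Lambda>: "0 < \<Lambda>" using M by (simp add: \<Lambda>_def)
    have "(\<Sum>n=1..M. k (int n) * w u x n)
        \<le> \<Lambda> powr (- 1) * (\<Sum>n=1..M. k (int n) powr (1 - 1)) + (4 ^ 1 * fact 1)\<^sup>2 * \<Lambda> * P"
      unfolding P_def by (rule weighted_sum_le[OF u]) (use \<Lambda> in auto)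
    also have "(\<Sum>n=1..M. k (int n) powr (1 - 1)) = real M"
    proof -
      have "(\<Sum>n=1..M. k (int n) powr (1 - 1)) = (\<Sum>n=1..M. 1)"
        using k_pos by (intro sum.cong) (auto simp: less_imp_neq[symmetric])
      then show ?thesis by simp
    qed
    also have "\<Lambda> powr (- 1) * real M = real M powr (- \<beta>)"
      using M by (simp add: \<Lambda>_def powr_powr powr_add powr_diff powr_minus field_simps)
    finally have head: "(\<Sum>n=1..M. k (int n) * w u x n) \<le> real M powr (- \<beta>) + 16 * \<Lambda> * P"
      by simp
    have tail: "(\<Sum>n\<in>{M<..N}. k (int n) * w u x n)
        \<le> C powr (1 - \<rho>) / \<gamma> * real M powr (- \<beta>) + (4 ^ m * fact m)\<^sup>2 * \<Lambda> * P" for N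
    proof -
      have "\<Lambda> powr (- \<rho>) * real M powr (- \<gamma>) = real M powr (- \<beta>)"
        unfolding \<Lambda>_def powr_powr powr_add[symmetric] by (simp add: \<gamma>_def algebra_simps)
      then have scale: "\<Lambda> powr (- \<rho>) * (C powr (1 - \<rho>) / \<gamma> * real M powr (- \<gamma>))
          = C powr (1 - \<rho>) / \<gamma> * real M powr (- \<beta>)" by (metis mult.left_commute)
      show ?thesis
        using tail_le[OF u M m \<rho>(1) \<Lambda> \<gamma>_def \<gamma>, where N = N and x = x]
        unfolding P_def scale .
    qed
    have "- gen_op k u x \<le> (1 + C powr (1 - \<rho>) / \<gamma>) * real M powr (- \<beta>)
        + (16 + (4 ^ m * fact m)\<^sup>2) * (\<Lambda> * P)"
    proof (rule minus_gen_op_le[OF u])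
      fix N assume "M \<le> N"
      then show "(\<Sum>n=1..N. k (int n) * w u x n) \<le> (1 + C powr (1 - \<rho>) / \<gamma>) * real M powr (- \<beta>)
        + (16 + (4 ^ m * fact m)\<^sup>2) * (\<Lambda> * P)"
        unfolding sum_split_at[OF \<open>M \<le> N\<close>]
        using head tail[of N] by (simp add: algebra_simps)
    qed
    also have "\<dots> \<le> K * real M powr (- \<beta>) + K * (\<Lambda> * P)"
      using P \<Lambda> by (intro add_mono mult_right_mono K) auto
    finally show "- gen_op k u x
        \<le> K * real M powr (- \<beta>) + K * real M powr (1 + \<beta>) * Psi2_Upsilon k u x"
      by (simp add: \<Lambda>_def P_def mult.assoc)
  qed
qed

text \<open>The optimal scale makes \<open>K * M powr (- \<beta>)\<close> half of \<open>s = - L u\<close>, that is \<open>M \<approx> s powr (- 1 / \<beta>)\<close>. Then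
  \<open>\<Psi>\<^sub>2\<^sub>,\<^sub>\<Upsilon>\<close> is at least of order \<open>s * M powr (- 1 - \<beta>)\<close>. The minimum with \<open>1\<close> keeps \<open>M \<ge> 1\<close>.\<close>

lemma Psi2_ge_powr:
  obtains A where "0 < A"
    "\<And>u x. bounded (range u) \<Longrightarrow> 0 < - gen_op k u x \<Longrightarrow>
       A * min 1 (- gen_op k u x) powr ((1 + 2 * \<beta>) / \<beta>) \<le> Psi2_Upsilon k u x"
proof -
  obtain K where K: "1 \<le> K" and main: "\<And>u x M. bounded (range u) \<Longrightarrow> 1 \<le> M \<Longrightarrow>
       - gen_op k u x \<le> K * real M powr (- \<beta>) + K * real M powr (1 + \<beta>) * Psi2_Upsilon k u x"
    using minus_gen_op_le_scale by blast
  define A where "A = 1 / (2 * K * 2 powr (1 + \<beta>) * (2 * K) powr ((1 + \<beta>) / \<beta>))"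
  show ?thesis
  proof
    show "0 < A" using K by (simp add: A_def)
    fix u :: "int \<Rightarrow> real" and x assume u: "bounded (range u)" and s: "0 < - gen_op k u x"
    define \<sigma> where "\<sigma> = min 1 (- gen_op k u x)"
    define P where "P = Psi2_Upsilon k u x"
    have P: "0 \<le> P" unfolding P_def by (rule Psi2_nonneg[OF u])
    have \<sigma>: "0 < \<sigma>" "\<sigma> \<le> 1" "\<sigma> \<le> - gen_op k u x" using s by (auto simp: \<sigma>_def)
    define X where "X = (2 * K / \<sigma>) powr (1 / \<beta>)"
    have q: "1 \<le> 2 * K / \<sigma>" using \<sigma> K by (simp add: field_simps)
    have "1 \<le> X" unfolding X_def using q \<beta>_pos by (intro ge_one_powr_ge_zero) auto
    then obtain M :: nat where M: "1 \<le> M" "X \<le> real M" "real M \<le> 2 * X"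
      using obtain_nat_between by blast
    have "real M powr (- \<beta>) \<le> X powr (- \<beta>)"
      using M \<open>1 \<le> X\<close> \<beta>_pos by (intro powr_mono2') auto
    also have "X powr (- \<beta>) = \<sigma> / (2 * K)"
      using q K \<sigma> \<beta>_pos unfolding X_def powr_powr by (simp add: powr_minus_divide)
    finally have "K * real M powr (- \<beta>) \<le> \<sigma> / 2" using K by (simp add: field_simps)
    moreover have "K * real M powr (1 + \<beta>) * P \<le> K * (2 * X) powr (1 + \<beta>) * P"
      using M K P \<beta>_pos by (intro mult_right_mono mult_left_mono powr_mono2) auto
    ultimately have "\<sigma> / 2 \<le> K * (2 * X) powr (1 + \<beta>) * P"
      using main[OF u M(1), of x] \<sigma>(3) unfolding P_def by linarith
    also have "(2 * X) powr (1 + \<beta>) = 2 powr (1 + \<beta>) * ((2 * K) powr ((1 + \<beta>) / \<beta>) / \<sigma> powr ((1 + \<beta>) / \<beta>))"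
      using \<sigma> K \<beta>_pos unfolding X_def by (simp add: powr_mult powr_powr powr_divide)
    finally have "A * (\<sigma> * \<sigma> powr ((1 + \<beta>) / \<beta>)) \<le> P"
      using K \<sigma> unfolding A_def by (simp add: field_simps)
    also have "\<sigma> * \<sigma> powr ((1 + \<beta>) / \<beta>) = \<sigma> powr ((1 + 2 * \<beta>) / \<beta>)"
    proof -
      have "(1 + 2 * \<beta>) / \<beta> = 1 + (1 + \<beta>) / \<beta>" using \<beta>_pos by (simp add: field_simps)
      then show ?thesis using \<sigma> by (simp add: powr_add)
    qed
    finally show "A * min 1 (- gen_op k u x) powr ((1 + 2 * \<beta>) / \<beta>) \<le> Psi2_Upsilon k u x"
      by (simp add: \<sigma>_def P_def)
  qed
qed

subsection \<open>Exponential lower bound\<close>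

text \<open>A single antidiagonal term already bounds \<open>w\<close> logarithmically in \<open>\<Psi>\<^sub>2\<^sub>,\<^sub>\<Upsilon>\<close>.\<close>

lemma w_le_ln:
  assumes u: "bounded (range u)" and n: "1 \<le> n"
  shows "w u x n \<le> 4 * ln (1 + sqrt (Psi2_Upsilon k u x)) + 4 * ln (1 + 1 / k (int n))"
proof -
  define P where "P = Psi2_Upsilon k u x"
  have P: "0 \<le> P" unfolding P_def by (rule Psi2_nonneg[OF u])
  define \<kappa> where "\<kappa> = k (int n)"
  have \<kappa>: "0 < \<kappa>" using k_pos[OF n] by (simp add: \<kappa>_def)
  have "w u x n \<le> 4 * ln (1 + sqrt P) + 4 * ln (1 + 1 / \<kappa>)"
  proof (cases "0 \<le> w u x n")
    case True
    have "\<kappa>\<^sup>2 * (exp (w u x n / 4) - 1)\<^sup>2 \<le> \<kappa>\<^sup>2 * sinh_sq (w u x n)"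
      by (intro mult_left_mono sinh_sq_ge_exp True) auto
    also have "\<dots> \<le> P"
      using sum_sinh_sq_le_Psi2[OF u, of "{n}" x] n by (simp add: P_def \<kappa>_def)
    finally have "(\<kappa> * (exp (w u x n / 4) - 1))\<^sup>2 \<le> P" by (simp add: power_mult_distrib)
    then have "\<kappa> * (exp (w u x n / 4) - 1) \<le> sqrt P" by (rule real_le_rsqrt)
    then have "exp (w u x n / 4) \<le> 1 + sqrt P / \<kappa>" using \<kappa> by (simp add: field_simps)
    also have "\<dots> \<le> (1 + sqrt P) * (1 + 1 / \<kappa>)" using P \<kappa> by (simp add: algebra_simps)
    finally have "w u x n / 4 \<le> ln ((1 + sqrt P) * (1 + 1 / \<kappa>))"
      using P \<kappa> by (subst ln_ge_iff) (auto intro!: mult_pos_pos add_pos_nonneg)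
    also have "\<dots> = ln (1 + sqrt P) + ln (1 + 1 / \<kappa>)"
      using P \<kappa> by (intro ln_mult_pos) (auto intro!: add_pos_nonneg)
    finally show ?thesis by simp
  next
    case False
    have "0 \<le> ln (1 + sqrt P)" "0 \<le> ln (1 + 1 / \<kappa>)" using P \<kappa> by (auto intro!: ln_ge_zero)
    then show ?thesis using False by linarith
  qed
  then show ?thesis by (simp add: P_def \<kappa>_def)
qed

lemma ln_inverse_kernel_le:
  obtains D where "0 \<le> D" "\<And>n. 1 \<le> n \<Longrightarrow> ln (1 + 1 / k (int n)) \<le> D * real n powr (\<beta> / 2)"
proof
  define D where "D = ln (1 + 1 / c) + (1 + \<beta>) / (\<beta> / 2)"
  show "0 \<le> D" unfolding D_def using c_pos \<beta>_pos by (intro add_nonneg_nonneg ln_ge_zero) auto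
  fix n :: nat assume n: "1 \<le> n"
  define N where "N = real n powr (1 + \<beta>)"
  have N: "1 \<le> N" unfolding N_def using n \<beta>_pos by (intro ge_one_powr_ge_zero) auto
  have "1 / k (int n) \<le> 1 / (c * real n powr (- 1 - \<beta>))"
    using lower[OF n] c_pos n by (intro divide_left_mono mult_pos_pos k_pos) auto
  also have "\<dots> = N / c"
  proof -
    have "real n powr (- 1 - \<beta>) = 1 / N" unfolding N_def by (simp add: powr_minus_divide[symmetric])
    then show ?thesis by simp
  qed
  finally have "1 + 1 / k (int n) \<le> (1 + 1 / c) * N" using N by (simp add: algebra_simps)
  then have "ln (1 + 1 / k (int n)) \<le> ln ((1 + 1 / c) * N)"
    using k_pos[OF n] N c_pos by (subst ln_le_cancel_iff) (auto intro!: add_pos_pos mult_pos_pos)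
  also have "\<dots> = ln (1 + 1 / c) + ln N"
    using N c_pos by (intro ln_mult_pos) (auto intro!: add_pos_pos)
  also have "ln N = (1 + \<beta>) * ln (real n)" using n by (simp add: N_def ln_powr)
  also have "\<dots> \<le> (1 + \<beta>) * (real n powr (\<beta> / 2) / (\<beta> / 2))"
    using n \<beta>_pos by (intro mult_left_mono ln_powr_bound) auto
  also have "ln (1 + 1 / c) \<le> ln (1 + 1 / c) * real n powr (\<beta> / 2)"
  proof -
    have "0 \<le> ln (1 + 1 / c)" using c_pos by (intro ln_ge_zero) auto
    moreover have "1 \<le> real n powr (\<beta> / 2)" using n \<beta>_pos by (intro ge_one_powr_ge_zero) auto
    ultimately show ?thesis by (simp add: mult_le_cancel_left1)
  qed
  finally show "ln (1 + 1 / k (int n)) \<le> D * real n powr (\<beta> / 2)"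
    by (simp add: D_def algebra_simps)
qed

text \<open>Multiplying the logarithmic bound on \<open>w\<close> by \<open>k\<close> and summing gives
  \<open>- L u \<le> K * (ln (1 + sqrt \<Psi>\<^sub>2\<^sub>,\<^sub>\<Upsilon>) + D)\<close>, which is solved for \<open>\<Psi>\<^sub>2\<^sub>,\<^sub>\<Upsilon>\<close>.\<close>

lemma Psi2_ge_exp:
  obtains B \<nu> s0 where "0 < B" "0 < \<nu>"
    "\<And>u x. bounded (range u) \<Longrightarrow> s0 \<le> - gen_op k u x \<Longrightarrow>
       B * exp (\<nu> * (- gen_op k u x)) \<le> Psi2_Upsilon k u x"
proof -
  obtain D where D: "0 \<le> D" "\<And>n. 1 \<le> n \<Longrightarrow> ln (1 + 1 / k (int n)) \<le> D * real n powr (\<beta> / 2)"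
    using ln_inverse_kernel_le by blast
  define K where "K = 4 * C * (1 + 1 / (\<beta> / 2))"
  have K: "0 < K" using C_pos \<beta>_pos by (simp add: K_def add_pos_pos)
  have main: "- gen_op k u x \<le> K * (ln (1 + sqrt (Psi2_Upsilon k u x)) + D)"
    if u: "bounded (range u)" for u x
  proof (rule minus_gen_op_le[OF u])
    fix N
    define l where "l = ln (1 + sqrt (Psi2_Upsilon k u x))"
    have l: "0 \<le> l" unfolding l_def using Psi2_nonneg[OF u] by (intro ln_ge_zero) auto
    have "(\<Sum>n=1..N. k (int n) * w u x n) \<le> (\<Sum>n=1..N. 4 * C * (l + D) * real n powr (- 1 - \<beta> / 2))"
    proof (rule sum_mono)
      fix n assume "n \<in> {1..N}"
      then have n: "1 \<le> n" by simp
      have n1: "1 \<le> real n powr (\<beta> / 2)" using n \<beta>_pos by (intro ge_one_powr_ge_zero) auto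
      have "l \<le> l * real n powr (\<beta> / 2)" using l n1 by (simp add: mult_le_cancel_left1)
      then have "w u x n \<le> 4 * (l + D) * real n powr (\<beta> / 2)"
        using w_le_ln[OF u n, of x] D(2)[OF n] unfolding l_def by (simp add: algebra_simps)
      then have "k (int n) * w u x n \<le> k (int n) * (4 * (l + D) * real n powr (\<beta> / 2))"
        using k_pos[OF n] by (intro mult_left_mono) auto
      also have "\<dots> \<le> (C * real n powr (- 1 - \<beta>)) * (4 * (l + D) * real n powr (\<beta> / 2))"
        using upper[OF n] l D by (intro mult_right_mono) auto
      also have "\<dots> = 4 * C * (l + D) * (real n powr (- 1 - \<beta>) * real n powr (\<beta> / 2))" by simp
      also have "real n powr (- 1 - \<beta>) * real n powr (\<beta> / 2) = real n powr (- 1 - \<beta> / 2)"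
        unfolding powr_add[symmetric] by (rule arg_cong[where f = "(powr) (real n)"]) simp
      finally show "k (int n) * w u x n \<le> 4 * C * (l + D) * real n powr (- 1 - \<beta> / 2)" .
    qed
    also have "\<dots> \<le> 4 * C * (l + D) * (1 + 1 / (\<beta> / 2))"
      unfolding sum_distrib_left[symmetric]
      using l D C_pos \<beta>_pos by (intro mult_left_mono sum_powr_le) auto
    also have "\<dots> = K * (l + D)" by (simp add: K_def)
    finally show "(\<Sum>n=1..N. k (int n) * w u x n) \<le> K * (ln (1 + sqrt (Psi2_Upsilon k u x)) + D)"
      unfolding l_def .
  qed
  \<comment> \<open>From \<open>s0\<close> on, \<open>exp (s / K - D) \<ge> 2\<close>, so subtracting \<open>1\<close> costs at most one half.\<close>
  define s0 where "s0 = K * (D + ln 2)"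
  define B where "B = exp (- 2 * D) / 4"
  show ?thesis
  proof
    show "0 < B" "0 < 2 / K" using K by (auto simp: B_def)
    fix u :: "int \<Rightarrow> real" and x assume u: "bounded (range u)" and s: "s0 \<le> - gen_op k u x"
    define s where "s = - gen_op k u x"
    define P where "P = Psi2_Upsilon k u x"
    have P: "0 \<le> P" unfolding P_def by (rule Psi2_nonneg[OF u])
    define y where "y = exp (s / K - D)"
    have "s \<le> K * (ln (1 + sqrt P) + D)" using main[OF u, of x] by (simp add: s_def P_def)
    then have "s / K - D \<le> ln (1 + sqrt P)" using K by (simp add: field_simps)
    then have "y \<le> 1 + sqrt P" unfolding y_def using P by (subst ln_ge_iff[symmetric]) (auto intro: add_pos_nonneg)
    moreover have "2 \<le> y"
    proof -
      have "ln 2 \<le> s / K - D" using s K unfolding s0_def s_def by (simp add: field_simps)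
      then have "exp (ln 2) \<le> y" unfolding y_def by (simp only: exp_le_cancel_iff)
      then show ?thesis by simp
    qed
    ultimately have "y / 2 \<le> sqrt P" by linarith
    then have "(y / 2)\<^sup>2 \<le> P" using P \<open>2 \<le> y\<close>
      by (metis (no_types, opaque_lifting) order_trans divide_nonneg_nonneg power_mono real_sqrt_pow2 zero_le_numeral)
    moreover have "(y / 2)\<^sup>2 = B * exp (2 / K * s)"
      unfolding y_def B_def by (simp add: power2_eq_square algebra_simps flip: exp_add)
    ultimately show "B * exp (2 / K * (- gen_op k u x)) \<le> Psi2_Upsilon k u x"
      by (simp add: s_def P_def)
  qed
qed

end

subsection \<open>Improved polynomial lower bound for kernels with finite first moment\<close>

text \<open>The terms with \<open>l = \<sigma>\<close> say how far the increments of \<open>u\<close> deviate from the increment \<open>u (x + \<sigma>) - u x\<close>. If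
  all deviations vanish then \<open>u\<close> is affine around \<open>x\<close>, on both sides with the same slope, and \<open>w\<close>
  vanishes. In general \<open>w\<close> is a signed sum of the deviations.\<close>

lemma w_le_sum_row:
  assumes "\<sigma> = 1 \<or> \<sigma> = - 1"
  shows "\<bar>second_diff u x (int n) (- int n)\<bar>
    \<le> (\<Sum>i\<in>{- int n..<int n}. \<bar>second_diff u x (\<sigma> * i) \<sigma>\<bar>)"
proof (induction n)
  case 0
  then show ?case by (simp add: second_diff_def)
next
  case (Suc n)
  define e where "e i = second_diff u x (\<sigma> * i) \<sigma>" for i
  have "second_diff u x (int (Suc n)) (- int (Suc n))
      = second_diff u x (int n) (- int n) - e (int n) + e (- int n - 1)"
    using assms
  proof (elim disjE)
    assume "\<sigma> = 1"
    then show ?thesis unfolding e_def second_diff_def by (simp add: algebra_simps)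
  next
    assume "\<sigma> = - 1"
    then show ?thesis unfolding e_def second_diff_def by (simp add: algebra_simps)
  qed
  then have "\<bar>second_diff u x (int (Suc n)) (- int (Suc n))\<bar>
      \<le> \<bar>second_diff u x (int n) (- int n)\<bar> + \<bar>e (int n)\<bar> + \<bar>e (- int n - 1)\<bar>"
    by linarith
  also have "\<dots> \<le> (\<Sum>i\<in>{- int n..<int n}. \<bar>e i\<bar>) + \<bar>e (int n)\<bar> + \<bar>e (- int n - 1)\<bar>"
    using Suc by (simp add: e_def)
  also have "\<dots> = (\<Sum>i\<in>{- int (Suc n)..<int (Suc n)}. \<bar>e i\<bar>)"
  proof -
    have "{- int (Suc n)..<int (Suc n)} = insert (int n) (insert (- int n - 1) {- int n..<int n})"
      by auto
    then show ?thesis by simp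
  qed
  finally show ?case by (simp add: e_def)
qed

context power_kernel
begin

lemma lower_int:
  assumes "i \<noteq> 0" "\<bar>i\<bar> \<le> int n"
  shows "c * real n powr (- 1 - \<beta>) \<le> k i"
proof -
  define m where "m = nat \<bar>i\<bar>"
  have m: "1 \<le> m" "m \<le> n" using assms by (auto simp: m_def)
  have "k i = k (int m)" using sym[of i] by (auto simp: m_def abs_if)
  moreover have "real n powr (- 1 - \<beta>) \<le> real m powr (- 1 - \<beta>)"
    using m \<beta>_pos by (intro powr_mono2') auto
  moreover from this have "c * real n powr (- 1 - \<beta>) \<le> c * real m powr (- 1 - \<beta>)"
    using c_pos by (intro mult_left_mono) auto
  ultimately show ?thesis using lower[OF m(1)] by linarith
qed

text \<open>If \<open>u\<close> dropped by more than \<open>1\<close> towards both neighbours, then the antidiagonal term at \<open>n = 1\<close> would be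
  large. So one neighbour \<open>\<sigma>\<close> has a weight \<open>exp (u (x + \<sigma>) - u x)\<close> bounded below.\<close>

lemma one_sided_increment:
  assumes u: "bounded (range u)" and small: "4 * Psi2_Upsilon k u x < c\<^sup>2"
  obtains \<sigma> where "\<sigma> = 1 \<or> \<sigma> = - 1" "- 1 \<le> u (x + \<sigma>) - u x"
proof (rule ccontr)
  assume "\<not> thesis"
  then have "u (x + 1) - u x < - 1" "u (x + - 1) - u x < - 1"
    using that[of 1] that[of "- 1"] by force+
  then have w: "2 \<le> w u x 1" by (simp add: second_diff_def)
  have "2 ^ (2 * 1) \<le> w u x 1 ^ (2 * 1)" using w by (intro power_mono) auto
  also have "\<dots> \<le> (4 ^ 1 * fact 1)\<^sup>2 * sinh_sq (w u x 1)"
    using w by (intro sinh_sq_ge_power) auto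
  finally have "1 / 4 \<le> sinh_sq (w u x 1)" by simp
  then have "(k 1)\<^sup>2 * (1 / 4) \<le> (k 1)\<^sup>2 * sinh_sq (w u x 1)" by (intro mult_left_mono) auto
  also have "\<dots> \<le> Psi2_Upsilon k u x"
    using sum_sinh_sq_le_Psi2[OF u, of "{1}" x] by simp
  finally have "(k 1)\<^sup>2 < c\<^sup>2" using small by simp
  moreover have "c\<^sup>2 \<le> (k 1)\<^sup>2" using c_le_k_1 c_pos by (intro power_mono) auto
  ultimately show False by linarith
qed

text \<open>For near jumps the terms with \<open>l = \<sigma>\<close> beat the antidiagonal: smallness of \<open>\<Psi>\<^sub>2\<^sub>,\<^sub>\<Upsilon>\<close> on the scale \<open>M\<close> forces every
  deviation \<open>e i\<close> into the range where \<open>Upsilon\<close> is quadratic. The Cauchy-Schwarz inequality then bounds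
  \<open>w\<close> at \<open>n\<close> by a constant times \<open>sqrt \<Psi>\<^sub>2\<^sub>,\<^sub>\<Upsilon> * n powr (1 + \<beta> / 2)\<close>, and summation
  against \<open>k\<close> over \<open>n \<le> M\<close> gives the factor \<open>M powr (1 - \<beta> / 2)\<close>.\<close>

lemma head_le:
  assumes u: "bounded (range u)" and M: "1 \<le> M" and \<beta>: "\<beta> < 2"
    and small: "96 * Psi2_Upsilon k u x \<le> c\<^sup>2 * real M powr (- 1 - \<beta>)"
  shows "(\<Sum>n=1..M. k (int n) * w u x n)
    \<le> 10 * C / (c * (1 - \<beta> / 2)) * sqrt (Psi2_Upsilon k u x) * real M powr (1 - \<beta> / 2)"
proof -
  define P where "P = Psi2_Upsilon k u x"
  have P: "0 \<le> P" unfolding P_def by (rule Psi2_nonneg[OF u])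
  have "real M powr (- 1 - \<beta>) \<le> 1"
    using powr_mono2'[of "- 1 - \<beta>" 1 "real M"] M \<beta>_pos by simp
  then have "c\<^sup>2 * real M powr (- 1 - \<beta>) \<le> c\<^sup>2" by (simp add: mult_le_cancel_left2)
  then have "4 * P < c\<^sup>2" using small P c_pos zero_less_power[OF c_pos, of 2]
    unfolding P_def[symmetric] by linarith
  then obtain \<sigma> where \<sigma>: "\<sigma> = 1 \<or> \<sigma> = - 1" "- 1 \<le> u (x + \<sigma>) - u x"
    using one_sided_increment[OF u] unfolding P_def by blast
  define e where "e i = second_diff u x (\<sigma> * i) \<sigma>" for i
  \<comment> \<open>Near \<open>i = 0\<close> the kernel gives no information, but there the deviation vanishes.\<close>
  have e0: "e 0 = 0" by (simp add: e_def second_diff_def)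
  have row: "(\<Sum>i\<in>A. k i * Upsilon (e i)) \<le> 6 * P / c" if "finite A" for A
  proof -
    define S where "S = (\<Sum>i\<in>A. k i * Upsilon (e i))"
    have S: "0 \<le> S" unfolding S_def by (intro sum_nonneg mult_nonneg_nonneg nonneg Upsilon_nonneg)
    have "c * (1 / 3) \<le> k 1 * exp (u (x + \<sigma>) - u x)"
    proof (intro mult_mono c_le_k_1)
      have "1 / 3 \<le> 1 / exp (1::real)" using exp_le by (intro divide_left_mono) auto
      also have "\<dots> = exp (- 1)" by (simp add: exp_minus inverse_eq_divide)
      also have "\<dots> \<le> exp (u (x + \<sigma>) - u x)" using \<sigma>(2) by simp
      finally show "1 / 3 \<le> exp (u (x + \<sigma>) - u x)" .
    qed (auto intro: nonneg)
    then have "c * (1 / 3) * S \<le> k 1 * exp (u (x + \<sigma>) - u x) * S"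
      using S by (rule mult_right_mono)
    also have "\<dots> \<le> 2 * P"
      using sum_row_le_Psi2[OF u that \<sigma>(1), of x] unfolding S_def e_def P_def .
    finally show ?thesis unfolding S_def[symmetric] using c_pos by (simp add: field_simps)
  qed
  have e_sq: "(e i)\<^sup>2 \<le> 8 * Upsilon (e i)" if "\<bar>i\<bar> \<le> int M" for i
  proof (cases "i = 0")
    case False
    \<comment> \<open>a lower bound for the kernel on jumps of length at most \<open>M\<close>\<close>
    define \<delta> where "\<delta> = c * real M powr (- 1 - \<beta>)"
    have \<delta>: "0 < \<delta>" using c_pos M by (simp add: \<delta>_def)
    have "\<delta> * Upsilon (e i) \<le> k i * Upsilon (e i)"
      unfolding \<delta>_def by (intro mult_right_mono lower_int False that Upsilon_nonneg)
    also have "\<dots> \<le> 6 * P / c" using row[of "{i}"] by simp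
    also have "\<dots> \<le> \<delta> * (1 / 16)"
    proof -
      have "96 * P \<le> c * \<delta>" using small by (simp add: \<delta>_def P_def power2_eq_square mult.assoc)
      then show ?thesis using c_pos by (simp add: pos_divide_le_eq mult.commute)
    qed
    finally have "Upsilon (e i) \<le> 1 / 16" using \<delta> by (simp only: mult_le_cancel_left_pos)
    then show ?thesis by (rule square_le_Upsilon)
  qed (simp add: e0 Upsilon_nonneg)
  have w_bound: "w u x n \<le> 10 * sqrt P / c * real n powr (1 + \<beta> / 2)" if n: "1 \<le> n" "n \<le> M" for n
  proof -
    define I where "I = {- int n..<int n}"
    define \<delta> where "\<delta> = c * real n powr (- 1 - \<beta>)"
    have \<delta>: "0 < \<delta>" using c_pos n by (simp add: \<delta>_def)
    have I: "finite I" "card I = 2 * n" by (auto simp: I_def)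
    have "\<delta> * (\<Sum>i\<in>I. (e i)\<^sup>2) \<le> (\<Sum>i\<in>I. 8 * (k i * Upsilon (e i)))"
      unfolding sum_distrib_left
    proof (rule sum_mono)
      fix i assume i: "i \<in> I"
      show "\<delta> * (e i)\<^sup>2 \<le> 8 * (k i * Upsilon (e i))"
      proof (cases "i = 0")
        case True
        then show ?thesis by (simp add: e0 nonneg Upsilon_nonneg)
      next
        case False
        have "\<bar>i\<bar> \<le> int n" using i by (auto simp: I_def)
        then have "\<delta> * (e i)\<^sup>2 \<le> k i * (8 * Upsilon (e i))"
          unfolding \<delta>_def using n False
          by (intro mult_mono lower_int e_sq) (auto intro: nonneg)
        then show ?thesis by simp
      qed
    qed
    also have "\<dots> \<le> 48 * P / c" using row[OF I(1)] by (simp flip: sum_distrib_left)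
    finally have sq: "\<delta> * (\<Sum>i\<in>I. (e i)\<^sup>2) \<le> 48 * P / c" .
    have "(w u x n)\<^sup>2 \<le> (\<Sum>i\<in>I. \<bar>e i\<bar>)\<^sup>2"
      using w_le_sum_row[OF \<sigma>(1), of u x n] unfolding I_def e_def
      by (intro power2_le_iff_abs_le[THEN iffD2] sum_nonneg) auto
    also have "\<dots> \<le> (\<Sum>i\<in>I. \<bar>e i\<bar>\<^sup>2) * card I"
      by (rule sum_squared_le_sum_of_squares)
    also have "\<dots> = (\<Sum>i\<in>I. (e i)\<^sup>2) * (2 * real n)" by (simp add: I)
    also have "\<dots> \<le> (48 * P / c / \<delta>) * (2 * real n)"
    proof (rule mult_right_mono)
      show "(\<Sum>i\<in>I. (e i)\<^sup>2) \<le> 48 * P / c / \<delta>"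
        unfolding pos_le_divide_eq[OF \<delta>] using sq by (simp only: mult.commute)
    qed simp
    also have "\<dots> = 96 * P / c\<^sup>2 * real n powr (2 + \<beta>)"
    proof -
      have "real n / real n powr (- 1 - \<beta>) = real n powr 1 / real n powr (- 1 - \<beta>)" using n by simp
      also have "\<dots> = real n powr (2 + \<beta>)" unfolding powr_diff[symmetric] by simp
      finally have quot: "real n / real n powr (- 1 - \<beta>) = real n powr (2 + \<beta>)" .
      have "48 * P / c / (c * y) * (2 * real n) = 96 * P / c\<^sup>2 * (real n / y)" for y
        by (simp add: power2_eq_square)
      from this[of "real n powr (- 1 - \<beta>)"] show ?thesis unfolding \<delta>_def quot .
    qed
    \<comment> \<open>rounding \<open>96\<close> up to a perfect square\<close>
    also have "\<dots> \<le> 100 * P / c\<^sup>2 * real n powr (2 + \<beta>)"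
      using P by (intro mult_right_mono divide_right_mono) auto
    also have "\<dots> = (10 * sqrt P / c * real n powr (1 + \<beta> / 2))\<^sup>2"
    proof -
      have "(real n powr (1 + \<beta> / 2))\<^sup>2 = real n powr (2 + \<beta>)"
        by (simp add: power2_eq_square flip: powr_add)
      then show ?thesis using P by (simp add: power_mult_distrib power_divide)
    qed
    finally show ?thesis
      by (rule power2_le_imp_le) (use P c_pos in simp)
  qed
  have "(\<Sum>n=1..M. k (int n) * w u x n) \<le> (\<Sum>n=1..M. 10 * C / c * sqrt P * real n powr (- (\<beta> / 2)))"
  proof (rule sum_mono)
    fix n assume "n \<in> {1..M}"
    then have n: "1 \<le> n" "n \<le> M" by auto
    have "k (int n) * w u x n \<le> k (int n) * (10 * sqrt P / c * real n powr (1 + \<beta> / 2))"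
      by (intro mult_left_mono w_bound n nonneg)
    also have "\<dots> \<le> C * real n powr (- 1 - \<beta>) * (10 * sqrt P / c * real n powr (1 + \<beta> / 2))"
      using P c_pos by (intro mult_right_mono upper n) auto
    also have "\<dots> = 10 * C / c * sqrt P * (real n powr (- 1 - \<beta>) * real n powr (1 + \<beta> / 2))"
      by simp
    also have "real n powr (- 1 - \<beta>) * real n powr (1 + \<beta> / 2) = real n powr (- (\<beta> / 2))"
      unfolding powr_add[symmetric] by simp
    finally show "k (int n) * w u x n \<le> 10 * C / c * sqrt P * real n powr (- (\<beta> / 2))" .
  qed
  also have "\<dots> \<le> 10 * C / c * sqrt P * (real M powr (1 - \<beta> / 2) / (1 - \<beta> / 2))"
    unfolding sum_distrib_left[symmetric]
    using P C_pos c_pos \<beta> \<beta>_pos by (intro mult_left_mono sum_powr_head_le) auto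
  finally show ?thesis unfolding P_def by simp
qed

text \<open>The far jumps are cut off with multiplier \<open>1\<close> at the price of a slightly slower decay \<open>M powr (- b)\<close>,
  \<open>b = \<beta> - 1 / \<beta>\<close>, so that \<open>M \<approx> s powr (- 1 / b)\<close> with \<open>s = - L u\<close>. The near jumps then give
  \<open>\<Psi>\<^sub>2\<^sub>,\<^sub>\<Upsilon> \<ge> A3 * s powr (2 + (2 - \<beta>) / b)\<close>, unless \<open>\<Psi>\<^sub>2\<^sub>,\<^sub>\<Upsilon>\<close> exceeds a multiple of \<open>M powr (- 1 - \<beta>)\<close> or of \<open>s\<close>. The
  value of \<open>b\<close> is the one for which \<open>(1 + \<beta>) / b\<close> equals the target exponent \<open>\<beta> / (\<beta> - 1)\<close>; the two other
  exponents are at most as large.\<close>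

lemma Psi2_ge_powr_improved:
  assumes \<beta>: "1 < \<beta>" "\<beta> < 2"
  obtains A where "0 < A"
    "\<And>u x. bounded (range u) \<Longrightarrow> 0 < - gen_op k u x \<Longrightarrow> - gen_op k u x \<le> 1 \<Longrightarrow>
       A * (- gen_op k u x) powr (\<beta> / (\<beta> - 1)) \<le> Psi2_Upsilon k u x"
proof -
  define b where "b = \<beta> - 1 / \<beta>"
  define p where "p = \<beta> / (\<beta> - 1)"
  have "1 / \<beta> < 1" using \<beta> by simp
  then have b: "0 < b" "\<beta> - 1 \<le> b" unfolding b_def using \<beta> by linarith+
  have p1: "1 \<le> p" using \<beta> by (simp add: p_def field_simps)
  have pb: "(1 + \<beta>) / b = p"
  proof -
    have "b = (\<beta> - 1) * (1 + \<beta>) / \<beta>" using \<beta> by (simp add: b_def field_simps)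
    then show ?thesis using \<beta> by (simp add: p_def)
  qed
  have p2: "2 + (2 - \<beta>) / b \<le> p"
  proof -
    have "(2 - \<beta>) / b \<le> (2 - \<beta>) / (\<beta> - 1)" using b \<beta> by (intro divide_left_mono) auto
    also have "\<dots> = p - 2" using \<beta> by (simp add: p_def field_simps)
    finally show ?thesis by simp
  qed
  obtain m \<rho> where m: "1 \<le> m" and \<rho>: "\<rho> = 1 / (2 * real m - 1)" "\<rho> * (1 + \<beta>) < 1 / \<beta>"
    using ex_small_rho[of "1 / \<beta>"] \<beta> by auto
  define \<gamma> where "\<gamma> = \<beta> - \<rho> * (1 + \<beta>)"
  have \<gamma>: "0 < \<gamma>" "b \<le> \<gamma>" using \<rho> b by (auto simp: \<gamma>_def b_def)
  define K where "K = 1 + C powr (1 - \<rho>) / \<gamma> + (4 ^ m * fact m)\<^sup>2 + 10 * C / (c * (1 - \<beta> / 2))"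
  have nn: "0 \<le> C powr (1 - \<rho>) / \<gamma>" "0 \<le> ((4 ^ m * fact m)\<^sup>2 :: real)" "0 \<le> 10 * C / (c * (1 - \<beta> / 2))"
    using \<gamma> C_pos c_pos \<beta> by auto
  have K: "C powr (1 - \<rho>) / \<gamma> \<le> K" "(4 ^ m * fact m)\<^sup>2 \<le> K" "10 * C / (c * (1 - \<beta> / 2)) \<le> K" "1 \<le> K"
    using nn unfolding K_def by linarith+
  define A1 where "A1 = c\<^sup>2 / (96 * 2 powr (1 + \<beta>) * (4 * K) powr p)"
  define A2 where "A2 = 1 / (4 * K)"
  define A3 where "A3 = 1 / (4 * K\<^sup>2 * 2 powr (2 - \<beta>) * (4 * K) powr ((2 - \<beta>) / b))"
  define A where "A = min A1 (min A2 A3)"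
  have A: "0 < A1" "0 < A2" "0 < A3" using K c_pos by (auto simp: A1_def A2_def A3_def)
  show ?thesis
  proof
    show "0 < A" using A by (simp add: A_def)
    fix u :: "int \<Rightarrow> real" and x
    assume u: "bounded (range u)" and s_pos: "0 < - gen_op k u x" and s_le: "- gen_op k u x \<le> 1"
    define s where "s = - gen_op k u x"
    define P where "P = Psi2_Upsilon k u x"
    have s: "0 < s" "s \<le> 1" using s_pos s_le by (auto simp: s_def)
    have P: "0 \<le> P" unfolding P_def by (rule Psi2_nonneg[OF u])
    define X where "X = (4 * K / s) powr (1 / b)"
    have q: "1 \<le> 4 * K / s" using s K by (simp add: field_simps)
    have X: "1 \<le> X" unfolding X_def using q b by (intro ge_one_powr_ge_zero) auto
    have Xpow: "(2 * X) powr t = 2 powr t * ((4 * K) powr (t / b) / s powr (t / b))" for t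
      using s K X unfolding X_def by (simp add: powr_mult powr_powr powr_divide)
    obtain M :: nat where M: "1 \<le> M" "X \<le> real M" "real M \<le> 2 * X"
      using obtain_nat_between[OF X] by blast
    have s_mono: "s powr p \<le> s powr t" if "t \<le> p" for t
      using s that by (intro powr_mono') auto
    consider (large) "c\<^sup>2 * real M powr (- 1 - \<beta>) < 96 * P" | (linear) "s / 4 < K * P"
      | (main) "96 * P \<le> c\<^sup>2 * real M powr (- 1 - \<beta>)" "K * P \<le> s / 4"
      by linarith
    then have "A * s powr p \<le> P"
    proof cases
      case large
      have "A1 * s powr p = c\<^sup>2 * (1 / (2 * X) powr (1 + \<beta>)) / 96"
        unfolding Xpow A1_def pb using s K by simp
      also have "1 / (2 * X) powr (1 + \<beta>) = (2 * X) powr (- 1 - \<beta>)"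
        using powr_minus_divide[of "2 * X" "1 + \<beta>"] by simp
      also have "c\<^sup>2 * (2 * X) powr (- 1 - \<beta>) / 96 \<le> c\<^sup>2 * real M powr (- 1 - \<beta>) / 96"
        using M \<beta> by (intro divide_right_mono mult_left_mono powr_mono2') auto
      also have "\<dots> \<le> P" using large by simp
      finally have "A1 * s powr p \<le> P" .
      moreover have "A * s powr p \<le> A1 * s powr p" by (intro mult_right_mono) (auto simp: A_def)
      ultimately show ?thesis by linarith
    next
      case linear
      have "A2 * s powr p \<le> A2 * s powr 1" using A p1 by (intro mult_left_mono s_mono) auto
      also have "\<dots> \<le> P" using linear s K by (simp add: A2_def field_simps)
      finally have "A2 * s powr p \<le> P" .
      moreover have "A * s powr p \<le> A2 * s powr p" by (intro mult_right_mono) (auto simp: A_def)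
      ultimately show ?thesis by linarith
    next
      case main
      have "real M powr (- \<gamma>) \<le> real M powr (- b)" using M \<gamma> by (intro powr_mono) auto
      also have "\<dots> \<le> X powr (- b)" using M X b by (intro powr_mono2') auto
      also have "X powr (- b) = s / (4 * K)"
        using q K s b unfolding X_def powr_powr by (simp add: powr_minus_divide)
      finally have "K * real M powr (- \<gamma>) \<le> s / 4" using K by (simp add: field_simps)
      moreover have "C powr (1 - \<rho>) / \<gamma> * real M powr (- \<gamma>) \<le> K * real M powr (- \<gamma>)"
        by (intro mult_right_mono K) auto
      moreover have "(4 ^ m * fact m)\<^sup>2 * P \<le> K * P"
        by (intro mult_right_mono K P)
      ultimately have tail: "(\<Sum>n\<in>{M<..N}. k (int n) * w u x n) \<le> s / 2" for N
        using tail_le[OF u M(1) m \<rho>(1) zero_less_one \<gamma>_def \<gamma>(1), where N = N and x = x] main(2)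
        unfolding P_def[symmetric] by simp
      have head: "(\<Sum>n=1..M. k (int n) * w u x n) \<le> K * sqrt P * real M powr (1 - \<beta> / 2)"
        using head_le[OF u M(1) \<beta>(2) main(1)[unfolded P_def]] unfolding P_def[symmetric]
        by (rule order_trans) (intro mult_right_mono K, use P in auto)
      have "s \<le> K * sqrt P * real M powr (1 - \<beta> / 2) + s / 2"
        unfolding s_def
      proof (rule minus_gen_op_le[OF u])
        fix N assume "M \<le> N"
        then show "(\<Sum>n=1..N. k (int n) * w u x n)
            \<le> K * sqrt P * real M powr (1 - \<beta> / 2) + - gen_op k u x / 2"
          unfolding sum_split_at[OF \<open>M \<le> N\<close>] using head tail[of N] unfolding s_def by linarith
      qed
      also have "real M powr (1 - \<beta> / 2) \<le> (2 * X) powr (1 - \<beta> / 2)"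
        using M \<beta> by (intro powr_mono2) auto
      finally have "s / 2 \<le> K * sqrt P * (2 * X) powr (1 - \<beta> / 2)"
        using K P by (simp add: mult_left_mono)
      then have "(s / 2)\<^sup>2 \<le> (K * sqrt P * (2 * X) powr (1 - \<beta> / 2))\<^sup>2"
        using s by (intro power_mono) auto
      also have "\<dots> = K\<^sup>2 * P * (2 * X) powr (2 - \<beta>)"
      proof -
        have "((2 * X) powr (1 - \<beta> / 2))\<^sup>2 = (2 * X) powr (2 - \<beta>)"
          by (simp add: power2_eq_square flip: powr_add)
        then show ?thesis using P by (simp add: power_mult_distrib)
      qed
      finally have "A3 * (s\<^sup>2 * s powr ((2 - \<beta>) / b)) \<le> P"
        unfolding Xpow A3_def using s K by (simp add: field_simps power2_eq_square)
      also have "s\<^sup>2 * s powr ((2 - \<beta>) / b) = s powr (2 + (2 - \<beta>) / b)"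
        using s by (simp add: powr_add)
      finally have "A3 * s powr (2 + (2 - \<beta>) / b) \<le> P" .
      moreover have "A3 * s powr p \<le> A3 * s powr (2 + (2 - \<beta>) / b)"
        using A by (intro mult_left_mono s_mono p2) auto
      moreover have "A * s powr p \<le> A3 * s powr p" by (intro mult_right_mono) (auto simp: A_def)
      ultimately show ?thesis by linarith
    qed
    then show "A * (- gen_op k u x) powr (\<beta> / (\<beta> - 1)) \<le> Psi2_Upsilon k u x"
      by (simp add: s_def P_def p_def)
  qed
qed

end

section \<open>CD-functions with prescribed asymptotics\<close>

text \<open>The quotient \<open>r / (p / \<nu> + r)\<close> switches off the power at infinity. The shift \<open>p / \<nu>\<close> is what makes
  \<open>F r / r\<close> increasing: the logarithmic derivative of \<open>(p / \<nu> + r) powr (- p)\<close> is at least \<open>- \<nu>\<close>, and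
  \<open>exp (\<nu> * r)\<close> compensates it.\<close>

lemma CD_function_powr_exp:
  assumes p: "1 < p" and \<nu>: "0 < \<nu>" and c: "0 < (c::real)"
  defines "F \<equiv> \<lambda>r. c * (r / (p / \<nu> + r)) powr p * exp (\<nu> * r)"
  shows "CD_function F"
    and "F \<sim>[at_right 0] (\<lambda>x. c * (\<nu> / p) powr p * x powr p)"
    and "F \<sim>[at_top] (\<lambda>x. c * exp (\<nu> * x))"
proof -
  define D where "D = p / \<nu>"
  have D: "0 < D" using p \<nu> by (simp add: D_def)
  have F: "F = (\<lambda>r. c * (r / (D + r)) powr p * exp (\<nu> * r))" by (simp add: F_def D_def)
  have nonneg: "0 \<le> F r" for r using c by (simp add: F)
  have cont: "continuous_on {0..} F"
    unfolding F using D p by (intro continuous_intros continuous_on_powr') auto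
  have mono: "strict_mono_on {0<..} (\<lambda>r. F r / r)"
  proof (rule strict_mono_onI)
    fix r s :: real assume "r \<in> {0<..}" "s \<in> {0<..}" and rs: "r < s"
    then have r: "0 < r" "0 < s" by auto
    have eq: "F t / t = c * (t powr (p - 1) * exp (\<nu> * t - p * ln (D + t)))" if "0 < t" for t
    proof -
      have quot: "(t / (D + t)) powr p = t powr p * exp (- (p * ln (D + t)))"
        using that D by (simp add: powr_divide exp_minus field_simps powr_def[of "D + t"])
      have "F t / t = c * ((t powr p / t) * (exp (- (p * ln (D + t))) * exp (\<nu> * t)))"
        unfolding F quot by simp
      also have "t powr p / t = t powr (p - 1)" using that by (simp add: powr_diff)
      also have "exp (- (p * ln (D + t))) * exp (\<nu> * t) = exp (\<nu> * t - p * ln (D + t))"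
        by (simp flip: exp_add)
      finally show ?thesis .
    qed
    have "ln (D + s) - ln (D + r) = ln ((D + s) / (D + r))" using r D by (simp add: ln_div)
    also have "\<dots> \<le> (D + s) / (D + r) - 1" using r D by (intro ln_le_minus_one) auto
    also have "\<dots> = (s - r) / (D + r)" using r D by (simp add: field_simps)
    also have "\<dots> \<le> (s - r) / D" using r rs D by (intro divide_left_mono) auto
    finally have "p * (ln (D + s) - ln (D + r)) \<le> p * ((s - r) / D)" using p by (intro mult_left_mono) auto
    also have "\<dots> = \<nu> * (s - r)" using p \<nu> by (simp add: D_def)
    finally have "\<nu> * r - p * ln (D + r) \<le> \<nu> * s - p * ln (D + s)" by (simp add: algebra_simps)
    moreover have "r powr (p - 1) < s powr (p - 1)" using r rs p by (intro powr_less_mono2) auto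
    ultimately have "r powr (p - 1) * exp (\<nu> * r - p * ln (D + r))
        < s powr (p - 1) * exp (\<nu> * s - p * ln (D + s))"
      by (intro mult_less_le_imp_less) auto
    then show "F r / r < F s / s" unfolding eq[OF r(1)] eq[OF r(2)] using c by simp
  qed
  have int: "set_integrable lborel {1..} (\<lambda>r. 1 / F r)"
  proof (rule set_integrable_bound)
    define a where "a = c * (1 / (D + 1)) powr p"
    have a: "0 < a" using c D by (simp add: a_def)
    have "(\<lambda>r. exp (- \<nu> * r)) integrable_on {1..}"
      using has_integral_exp_minus_to_infinity[OF \<nu>, of 1] by (rule has_integral_integrable)
    then have "(\<lambda>r. exp (- \<nu> * r)) absolutely_integrable_on {1..}"
      by (rule nonnegative_absolutely_integrable_1) simp
    then have "set_integrable lborel {1..} (\<lambda>r. exp (- \<nu> * r))"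
      unfolding set_integrable_def by (subst (asm) integrable_completion) auto
    then have "set_integrable lborel {1..} (\<lambda>r. exp (- \<nu> * r) / a)"
      using a by (intro set_integrable_divide) auto
    then show "set_integrable lborel {1..} (\<lambda>r. exp (- (r * \<nu>)) / a)" by (simp add: mult.commute)
    show "set_borel_measurable lborel {1..} (\<lambda>r. 1 / F r)"
      unfolding F set_borel_measurable_def by measurable
    show "AE r in lborel. r \<in> {1..} \<longrightarrow> norm (1 / F r) \<le> norm (exp (- (r * \<nu>)) / a)"
    proof (intro AE_I2 impI)
      fix r :: real assume "r \<in> {1..}"
      then have r: "1 \<le> r" by simp
      have "1 / (D + 1) \<le> r / (D + r)" using r D by (simp add: field_simps)
      then have "(1 / (D + 1)) powr p \<le> (r / (D + r)) powr p" using D p by (intro powr_mono2) auto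
      then have "a * exp (\<nu> * r) \<le> F r" unfolding F a_def using c by (intro mult_right_mono mult_left_mono) auto
      then have "1 / F r \<le> 1 / (a * exp (\<nu> * r))" using a by (intro divide_left_mono) (auto intro!: mult_pos_pos elim: less_le_trans[rotated])
      also have "\<dots> = exp (- (r * \<nu>)) / a" by (simp add: exp_minus field_simps)
      finally show "norm (1 / F r) \<le> norm (exp (- (r * \<nu>)) / a)" using nonneg[of r] a by simp
    qed
  qed
  show "CD_function F"
    unfolding CD_function_def
  proof (intro conjI allI impI exI[of _ 1])
    show "F 0 = 0" by (simp add: F)
  qed (use nonneg cont mono int in auto)
  show "F \<sim>[at_right 0] (\<lambda>x. c * (\<nu> / p) powr p * x powr p)"
  proof (rule asymp_equivI')
    have "((\<lambda>x. (D / (D + x)) powr p * exp (\<nu> * x)) \<longlongrightarrow> (D / (D + 0)) powr p * exp (\<nu> * 0)) (at_right 0)"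
      using D by (intro tendsto_intros) auto
    then have lim: "((\<lambda>x. (D / (D + x)) powr p * exp (\<nu> * x)) \<longlongrightarrow> 1) (at_right 0)" using D by simp
    have "(D / (D + x)) powr p * exp (\<nu> * x) = F x / (c * (\<nu> / p) powr p * x powr p)" if "0 < x" for x
    proof -
      have "D / (D + x) = x / (D + x) / (x / D)" using that D by simp
      also have "\<dots> powr p = (x / (D + x)) powr p / (x / D) powr p"
        using that D by (subst powr_divide) auto
      also have "x / D = \<nu> / p * x" by (simp add: D_def)
      also have "\<dots> powr p = (\<nu> / p) powr p * x powr p"
        using that p \<nu> by (subst powr_mult) auto
      finally have "(D / (D + x)) powr p = (x / (D + x)) powr p / ((\<nu> / p) powr p * x powr p)" .
      then show ?thesis unfolding F using c by simp
    qed
    then show "((\<lambda>x. F x / (c * (\<nu> / p) powr p * x powr p)) \<longlongrightarrow> 1) (at_right 0)"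
      by (intro Lim_transform_eventually[OF lim] eventually_mono[OF eventually_at_right_less]) auto
  qed
  show "F \<sim>[at_top] (\<lambda>x. c * exp (\<nu> * x))"
  proof (rule asymp_equivI')
    have comp: "((\<lambda>x. 1 - D / (D + x)) \<longlongrightarrow> 1 - 0) at_top"
      by (intro tendsto_intros tendsto_divide_0[OF tendsto_const] filterlim_at_top_imp_at_infinity
          filterlim_tendsto_add_at_top[OF tendsto_const filterlim_ident])
    have "1 - D / (D + x) = x / (D + x)" if "0 < x" for x
      using that D by (simp add: field_simps)
    then have "\<forall>\<^sub>F x in at_top. 1 - D / (D + x) = x / (D + x)"
      by (intro eventually_mono[OF eventually_gt_at_top[of 0]]) auto
    from Lim_transform_eventually[OF comp this]
    have "((\<lambda>x. x / (D + x)) \<longlongrightarrow> 1) at_top" by simp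
    then have lim: "((\<lambda>x. (x / (D + x)) powr p) \<longlongrightarrow> 1 powr p) at_top" by (intro tendsto_intros) auto
    have "F x / (c * exp (\<nu> * x)) = (x / (D + x)) powr p" for x
      unfolding F using c by simp
    then show "((\<lambda>x. F x / (c * exp (\<nu> * x))) \<longlongrightarrow> 1) at_top" using lim by simp
  qed
qed

text \<open>Lower bounds with the required behaviour at \<open>0\<close> and at \<open>\<infinity>\<close> can be replaced by a multiple of the model
  function. On the intermediate range the minimum with \<open>1\<close> provides a positive constant, so a small
  prefactor \<open>c\<close> suffices there.\<close>

lemma CD_Upsilon_0_of_coercivity:
  assumes nonneg: "\<And>u x. bounded (range u) \<Longrightarrow> 0 \<le> Psi2_Upsilon k u x"
    and A: "0 < A" and p: "1 < p"
    and small: "\<And>u x. bounded (range u) \<Longrightarrow> 0 < - gen_op k u x \<Longrightarrow>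
       A * min 1 (- gen_op k u x) powr p \<le> Psi2_Upsilon k u x"
    and B: "0 < B" and \<nu>: "0 < \<nu>"
    and large: "\<And>u x. bounded (range u) \<Longrightarrow> s0 \<le> - gen_op k u x \<Longrightarrow>
       B * exp (\<nu> * (- gen_op k u x)) \<le> Psi2_Upsilon k u x"
  shows "\<exists>c1>0. \<exists>c2>0. \<exists>\<nu>>0. \<exists>F. CD_function F \<and> CD_Upsilon_0 k F \<and>
     F \<sim>[at_right 0] (\<lambda>x. c1 * x powr p) \<and> F \<sim>[at_top] (\<lambda>x. c2 * exp (\<nu> * x))"
proof -
  define D where "D = p / \<nu>"
  have D: "0 < D" using p \<nu> by (simp add: D_def)
  define S where "S = max 1 s0"
  define c where "c = min B (A / ((1 + 1 / D powr p) * exp (\<nu> * S)))"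
  have c: "0 < c" "c \<le> B" using A B D by (auto simp: c_def add_pos_pos)
  define F where "F = (\<lambda>r. c * (r / (p / \<nu> + r)) powr p * exp (\<nu> * r))"
  have F: "F r = c * (r / (D + r)) powr p * exp (\<nu> * r)" for r by (simp add: F_def D_def)
  note CD = CD_function_powr_exp[OF p \<nu> c(1), folded F_def]
  have le_exp: "F r \<le> B * exp (\<nu> * r)" if "0 \<le> r" for r
  proof -
    have "(r / (D + r)) powr p \<le> 1 powr p"
      using that D p by (intro powr_mono2) (auto simp: divide_le_eq)
    then have "c * (r / (D + r)) powr p \<le> B * 1" using c that by (intro mult_mono) auto
    then show ?thesis unfolding F by (intro mult_right_mono) auto
  qed
  have le_powr: "F r \<le> A * min 1 r powr p" if "0 < r" "r \<le> S" for r
  proof -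
    have "(r / (D + r)) powr p \<le> (1 + 1 / D powr p) * min 1 r powr p"
    proof (cases "r \<le> 1")
      case True
      have "(r / (D + r)) powr p \<le> (r / D) powr p"
        using that D p by (intro powr_mono2 divide_left_mono) auto
      also have "\<dots> = 1 / D powr p * r powr p" using that D by (simp add: powr_divide)
      also have "\<dots> \<le> (1 + 1 / D powr p) * r powr p" by (intro mult_right_mono) auto
      finally show ?thesis using True by (simp add: min_def)
    next
      case False
      have "(r / (D + r)) powr p \<le> 1 powr p"
        using that D p by (intro powr_mono2) (auto simp: divide_le_eq)
      then show ?thesis using False by (simp add: min_def add_increasing2)
    qed
    then have "(r / (D + r)) powr p * exp (\<nu> * r)
        \<le> (1 + 1 / D powr p) * min 1 r powr p * exp (\<nu> * S)"
      using that \<nu> by (intro mult_mono) auto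
    then have "F r \<le> c * ((1 + 1 / D powr p) * min 1 r powr p * exp (\<nu> * S))"
      unfolding F mult.assoc using c by (intro mult_left_mono) auto
    also have "\<dots> = c * ((1 + 1 / D powr p) * exp (\<nu> * S)) * min 1 r powr p" by simp
    also have "\<dots> \<le> A * min 1 r powr p"
    proof (rule mult_right_mono)
      have pos: "0 < (1 + 1 / D powr p) * exp (\<nu> * S)" using D by (simp add: add_pos_pos)
      have "c \<le> A / ((1 + 1 / D powr p) * exp (\<nu> * S))" by (simp add: c_def)
      then show "c * ((1 + 1 / D powr p) * exp (\<nu> * S)) \<le> A" unfolding pos_le_divide_eq[OF pos] .
    qed simp
    finally show ?thesis .
  qed
  have "CD_Upsilon_0 k F"
    unfolding CD_Upsilon_0_def
  proof (intro allI impI)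
    fix u :: "int \<Rightarrow> real" and x assume u: "bounded (range u)"
    have "F (- gen_op k u x) \<le> Psi2_Upsilon k u x" if "0 \<le> - gen_op k u x"
    proof -
      consider "- gen_op k u x = 0" | "0 < - gen_op k u x" "- gen_op k u x \<le> S" | "S < - gen_op k u x"
        using \<open>0 \<le> - gen_op k u x\<close> by linarith
      then show ?thesis
      proof cases
        case 1
        then show ?thesis using nonneg[OF u] by (simp add: F)
      next
        case 2
        then show ?thesis using le_powr small[OF u 2(1)] by (meson order_trans)
      next
        case 3
        then have "s0 \<le> - gen_op k u x" by (simp add: S_def)
        then show ?thesis using le_exp[OF that] large[OF u] by (meson order_trans)
      qed
    qed
    then show "if 0 \<le> - gen_op k u x then F (- gen_op k u x) \<le> Psi2_Upsilon k u x
        else 0 \<le> Psi2_Upsilon k u x"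
      using nonneg[OF u] by simp
  qed
  moreover have "0 < c * (\<nu> / p) powr p" using c p \<nu> by simp
  ultimately show ?thesis using CD c(1) \<nu> by blast
qed

section \<open>The fractional discrete Laplacian\<close>

lemma summable_on_int_of_nat_bound:
  fixes k :: "int \<Rightarrow> real"
  assumes nonneg: "\<And>j. 0 \<le> k j" and sym: "\<And>j. k (- j) = k j"
    and bound: "\<And>N. (\<Sum>n=1..N. k (int n)) \<le> b"
  shows "k summable_on UNIV"
proof (rule nonneg_bdd_above_summable_on)
  show "bdd_above (sum k ` {F. F \<subseteq> UNIV \<and> finite F})"
  proof (rule bdd_aboveI2)
    fix F :: "int set" assume "F \<in> {F. F \<subseteq> UNIV \<and> finite F}"
    then have "finite F" by simp
    then obtain N where "F \<subseteq> {- int N..int N}"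
      by (rule finite_subset_symmetric_interval)
    then have "sum k F \<le> sum k {- int N..int N}"
      using nonneg by (intro sum_mono2) auto
    also have "\<dots> = k 0 + 2 * (\<Sum>n=1..N. k (int n))"
      unfolding sum_symmetric_interval by (simp add: sym sum_distrib_left)
    also have "\<dots> \<le> k 0 + 2 * b" using bound[of N] by simp
    finally show "sum k F \<le> k 0 + 2 * b" .
  qed
qed (use nonneg in auto)

lemma frac_kernel_power_kernel:
  assumes "0 < \<beta>" "\<beta> < 2"
  obtains c C where "power_kernel (frac_kernel \<beta>) \<beta> c C"
proof -
  obtain c C where c: "0 < c"
    and lower: "\<And>n. 1 \<le> n \<Longrightarrow> c * real n powr (- 1 - \<beta>) \<le> frac_kernel \<beta> (int n)"
    and upper: "\<And>n. 1 \<le> n \<Longrightarrow> frac_kernel \<beta> (int n) \<le> C * real n powr (- 1 - \<beta>)"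
    using frac_kernel_bounds[OF assms] by blast
  have sym: "frac_kernel \<beta> (- j) = frac_kernel \<beta> j" for j by (simp add: frac_kernel_def)
  have nonneg: "0 \<le> frac_kernel \<beta> j" for j
  proof (cases "j = 0")
    case False
    define n where "n = nat \<bar>j\<bar>"
    have "1 \<le> n" using False by (auto simp: n_def)
    have "0 \<le> c * real n powr (- 1 - \<beta>)" using c by simp
    also have "\<dots> \<le> frac_kernel \<beta> (int n)" by (rule lower[OF \<open>1 \<le> n\<close>])
    also have "\<dots> = frac_kernel \<beta> j" by (simp add: frac_kernel_def n_def)
    finally show ?thesis .
  qed (simp add: frac_kernel_def)
  have C: "0 \<le> C" using upper[of 1] nonneg[of 1] by simp
  have "(\<Sum>n=1..N. frac_kernel \<beta> (int n)) \<le> C * (1 + 1 / \<beta>)" for N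
  proof -
    have "(\<Sum>n=1..N. frac_kernel \<beta> (int n)) \<le> (\<Sum>n=1..N. C * real n powr (- 1 - \<beta>))"
      by (intro sum_mono upper) auto
    also have "\<dots> \<le> C * (1 + 1 / \<beta>)"
      unfolding sum_distrib_left[symmetric] using assms C by (intro mult_left_mono sum_powr_le) auto
    finally show ?thesis .
  qed
  then have "frac_kernel \<beta> summable_on UNIV"
    using summable_on_int_of_nat_bound[of "frac_kernel \<beta>"] nonneg sym by blast
  then have "power_kernel (frac_kernel \<beta>) \<beta> c C"
    using nonneg sym assms c lower upper by unfold_locales auto
  then show ?thesis by (rule that)
qed

theorem corollary4p7:
  fixes \<beta> :: real
  assumes "0 < \<beta>" and "\<beta> < 2"
  shows "(\<beta> \<le> (1 + sqrt 5) / 2 \<longrightarrow>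
            (\<exists>c1>0. \<exists>c2>0. \<exists>\<nu>>0. \<exists>F. CD_function F \<and> CD_Upsilon_0 (frac_kernel \<beta>) F \<and>
               F \<sim>[at_right 0] (\<lambda>x. c1 * x powr ((1 + 2 * \<beta>) / \<beta>)) \<and>
               F \<sim>[at_top] (\<lambda>x. c2 * exp (\<nu> * x)))) \<and>
         ((1 + sqrt 5) / 2 < \<beta> \<longrightarrow>
            (\<forall>\<epsilon>\<in>{0<..<\<beta> - 1}. \<exists>c3>0. \<exists>c4>0. \<exists>\<nu>>0. \<exists>F. CD_function F \<and> CD_Upsilon_0 (frac_kernel \<beta>) F \<and>
               F \<sim>[at_right 0] (\<lambda>x. c3 * x powr ((\<beta> - \<epsilon>) / (\<beta> - \<epsilon> - 1))) \<and>
               F \<sim>[at_top] (\<lambda>x. c4 * exp (\<nu> * x))))"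
proof -
  obtain c C where "power_kernel (frac_kernel \<beta>) \<beta> c C"
    using frac_kernel_power_kernel[OF assms] by blast
  then interpret power_kernel "frac_kernel \<beta>" \<beta> c C .
  obtain B \<nu> s0 where B: "0 < B" "0 < \<nu>"
    and large: "\<And>u x. bounded (range u) \<Longrightarrow> s0 \<le> - gen_op (frac_kernel \<beta>) u x \<Longrightarrow>
       B * exp (\<nu> * (- gen_op (frac_kernel \<beta>) u x)) \<le> Psi2_Upsilon (frac_kernel \<beta>) u x"
    using Psi2_ge_exp by blast
  obtain A where A: "0 < A"
    and small: "\<And>u x. bounded (range u) \<Longrightarrow> 0 < - gen_op (frac_kernel \<beta>) u x \<Longrightarrow>
       A * min 1 (- gen_op (frac_kernel \<beta>) u x) powr ((1 + 2 * \<beta>) / \<beta>)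
         \<le> Psi2_Upsilon (frac_kernel \<beta>) u x"
    using Psi2_ge_powr by blast
  have "1 < (1 + 2 * \<beta>) / \<beta>" using assms by (simp add: field_simps)
  then have a: "\<exists>c1>0. \<exists>c2>0. \<exists>\<nu>>0. \<exists>F. CD_function F \<and> CD_Upsilon_0 (frac_kernel \<beta>) F \<and>
      F \<sim>[at_right 0] (\<lambda>x. c1 * x powr ((1 + 2 * \<beta>) / \<beta>)) \<and> F \<sim>[at_top] (\<lambda>x. c2 * exp (\<nu> * x))"
    using CD_Upsilon_0_of_coercivity[OF Psi2_nonneg A _ small B large] by blast
  have b: "\<exists>c3>0. \<exists>c4>0. \<exists>\<nu>>0. \<exists>F. CD_function F \<and> CD_Upsilon_0 (frac_kernel \<beta>) F \<and>
      F \<sim>[at_right 0] (\<lambda>x. c3 * x powr ((\<beta> - \<epsilon>) / (\<beta> - \<epsilon> - 1))) \<and> F \<sim>[at_top] (\<lambda>x. c4 * exp (\<nu> * x))"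
    if \<epsilon>: "\<epsilon> \<in> {0<..<\<beta> - 1}" for \<epsilon>
  proof -
    have \<beta>: "1 < \<beta>" using \<epsilon> by simp
    obtain A' where A': "0 < A'"
      and small': "\<And>u x. bounded (range u) \<Longrightarrow> 0 < - gen_op (frac_kernel \<beta>) u x \<Longrightarrow>
         - gen_op (frac_kernel \<beta>) u x \<le> 1 \<Longrightarrow>
         A' * (- gen_op (frac_kernel \<beta>) u x) powr (\<beta> / (\<beta> - 1)) \<le> Psi2_Upsilon (frac_kernel \<beta>) u x"
      using Psi2_ge_powr_improved[OF \<beta> assms(2)] by blast
    define p where "p = (\<beta> - \<epsilon>) / (\<beta> - \<epsilon> - 1)"
    \<comment> \<open>The exponent asked for is larger than \<open>\<beta> / (\<beta> - 1)\<close>, hence the bound weaker for \<open>s \<le> 1\<close>.\<close>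
    have "\<beta> / (\<beta> - 1) = 1 + 1 / (\<beta> - 1)" using \<beta> by (simp add: field_simps)
    also have "\<dots> \<le> 1 + 1 / (\<beta> - \<epsilon> - 1)"
      using \<epsilon> by (intro add_left_mono divide_left_mono) auto
    also have "\<dots> = p" using \<epsilon> unfolding p_def by (simp add: field_simps)
    finally have p: "\<beta> / (\<beta> - 1) \<le> p" .
    have p1: "1 < p" using \<epsilon> unfolding p_def by (simp add: field_simps)
    have "min A A' * min 1 (- gen_op (frac_kernel \<beta>) u x) powr p \<le> Psi2_Upsilon (frac_kernel \<beta>) u x"
      if u: "bounded (range u)" and s: "0 < - gen_op (frac_kernel \<beta>) u x" for u x
    proof (cases "- gen_op (frac_kernel \<beta>) u x \<le> 1")
      case True
      define s where "s = - gen_op (frac_kernel \<beta>) u x"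
      have "min A A' * s powr p \<le> A' * s powr (\<beta> / (\<beta> - 1))"
        using A A' p True s unfolding s_def[symmetric] by (intro mult_mono powr_mono') auto
      then show ?thesis using small'[OF u s True] True unfolding s_def by simp
    next
      case False
      then show ?thesis using small[OF u s] by (simp add: min_def split: if_splits)
    qed
    then show ?thesis
      using CD_Upsilon_0_of_coercivity[OF Psi2_nonneg _ p1 _ B large, of "min A A'"] A A'
      unfolding p_def by simp
  qed
  from a b show ?thesis by blast
qed

end
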